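(* Suppose $\delta>0$. Let $\{(L_k,Z_k,S_k,Y_k)\}_{k\in\mathbb{Z}_+}$ denote the ADMIP iterates (defined in the context) corresponding to the penalty multiplier sequence $\{\rho_k\}_{k\in\mathbb{Z}_+}$, and let $\{\theta_k\}_{k\in\mathbb{Z}_+}$ be the sequence such that $\theta_k\ge 0$ is the optimal Lagrangian dual variable (multiplier) corresponding to the constraint in the problem $$\min_{Z,S\in\mathbb{R}^{m\times n}}\Big\{\xi\|S\|_1+\langle -Y_k, Z-L_{k+1}\rangle+\tfrac{\rho_k}{2}\|Z-L_{k+1}\|_F^2:\ \tfrac12\|\pi_\Omega(Z+S-D)\|_F^2\le \tfrac{\delta^2}{2}\Big\}.$$ (i) Suppose $\{\rho_k\}_{k\in\mathbb{Z}_+}$ is a non-decreasing sequence such that $\sum_{k\in\mathbb{Z}_+}\frac{1}{\rho_k}=\infty$. Then $L^*:=\lim_{k\to\infty}Z_k=\lim_{k\to\infty}L_k$ and $S^*:=\lim_{k\to\infty}S_k$ exist, and $(L^*,S^* )$ is an optimal solution of the SPCP problem $$\min_{L,S\in\mathbb{R}^{m\times n}}\{\|L\|_*+\xi\|S\|_1:\ \|\pi_\Omega(L+S-D)\|_F\le\delta\}.$$ (ii) Suppose $\{\rho_k\}_{k\in\mathbb{Z}_+}$ is a non-decreasing sequence such that $\sum_{k\in\mathbb{Z}_+}\frac{1}{\rho_k^2}=\infty$, and let $L^*=\lim_{k\to\infty} Z_k=\lim_{k\to\infty}L_k$ and $S^*=\lim_{k\to\infty}S_k$ be the limits as in part (i).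 In the case that $\|\pi_\Omega(D-L^* )\|_F\ne\delta$, the limit $(Y^*,\theta^* ):=\lim_{k\to\infty}(Y_k,\theta_k)$ exists, and $(L^*,L^*,S^*,Y^*,\theta^* )$ is a saddle point of the Lagrangian function $$\mathcal{L}(L,Z,S;Y,\theta)=\|L\|_*+\xi\|S\|_1+\langle Y,L-Z\rangle+\frac{\theta}{2}\left(\|\pi_\Omega(Z+S-D)\|_F^2-\delta^2\right)$$ (minimized over $L,Z,S\in\mathbb{R}^{m\times n}$, maximized over $Y\in\mathbb{R}^{m\times n}$, $\theta\ge0$). Otherwise, i.e. when $\|\pi_\Omega(D-L^* )\|_F=\delta$, the sequence $\{(Y_k,\theta_k)\}_{k\in\mathbb{Z}_+}$ has a limit point $(Y^*,\theta^* )$ such that $(Y^*,\theta^* )\in\operatorname{argmax}_{Y,\theta}\{\mathcal{L}(L^*,L^*,S^*;Y,\theta):\ \theta\ge0\}$.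
   Context: Fix positive integers $m,n$, a matrix $D\in\mathbb{R}^{m\times n}$, a set $\Omega\subset\{1,\dots,m\}\times\{1,\dots,n\}$, $\delta\geq 0$, and $\xi=1/\sqrt{\max\{m,n\}}$. The map $\pi_\Omega:\mathbb{R}^{m\times n}\to\mathbb{R}^{m\times n}$ is $(\pi_\Omega(L))_{ij}=L_{ij}$ if $(i,j)\in\Omega$ and $0$ otherwise. $\|\cdot\|_*$ is the nuclear norm (sum of singular values), $\|L\|_1=\sum_{i,j}|L_{ij}|$, $\|\cdot\|_F$ is the Frobenius norm, $\langle\cdot,\cdot\rangle$ is the corresponding trace inner product, and $\mathbb{Z}_+$ is the set of nonnegative integers. ADMIP (alternating direction method with increasing penalty): the input is $Z_0,Y_0\in\mathbb{R}^{m\times n}$ (arbitrary) and a sequence of penalties $\{\rho_k\}_{k\in\mathbb{Z}_+}$ of positive reals with $\rho_{k+1}\ge\rho_k$ for all $k$ and $\rho_k\to\infty$. For $k=0,1,2,\dots$ the iterates are defined by $$L_{k+1}=\operatorname{argmin}_{L\in\mathbb{R}^{m\times n}}\Big\{\|L\|_*+\langle Y_k,L-Z_k\rangle+\tfrac{\rho_k}{2}\|L-Z_k\|_F^2\Big\},$$ $$(Z_{k+1},S_{k+1})=\operatorname{argmin}_{(Z,S):\ \|\pi_\Omega(Z+S-D)\|_F\le\delta}\Big\{\xi\|S\|_1+\langle -Y_k,Z-L_{k+1}\rangle+\tfrac{\rho_k}{2}\|Z-L_{k+1}\|_F^2\Big\},$$ $$Y_{k+1}=Y_k+\rho_k(L_{k+1}-Z_{k+1}).$$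 Thus $Z_k,Y_k$ are defined for $k\ge0$ and $L_k,S_k$ for $k\ge1$. *)

theory Defs
  imports "HOL-Analysis.Analysis"
begin

text \<open>
  Matrices are elements of \<open>real ^ 'n ^ 'm\<close>. On this type the library's \<open>norm\<close> is the
  Frobenius norm and the library's inner product is the trace inner product.
\<close>

definition singular_value :: "real ^ 'n ^ 'm \<Rightarrow> real \<Rightarrow> bool" where
  "singular_value A \<sigma> \<longleftrightarrow>
     0 \<le> \<sigma> \<and> (\<exists>v. v \<noteq> 0 \<and> (transpose A ** A) *v v = \<sigma>\<^sup>2 *\<^sub>R v)"

text \<open>
  Since \<open>transpose A ** A\<close> is symmetric, the algebraic multiplicity of an eigenvalue is the
  dimension of its eigenspace. If \<open>A\<close> has more columns than rows, this counts additional zero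
  singular values, which do not contribute to the nuclear norm.
\<close>

definition singular_value_mult :: "real ^ 'n ^ 'm \<Rightarrow> real \<Rightarrow> nat" where
  "singular_value_mult A \<sigma> = dim {v. (transpose A ** A) *v v = \<sigma>\<^sup>2 *\<^sub>R v}"

definition nuclear_norm :: "real ^ 'n ^ 'm \<Rightarrow> real" where
  "nuclear_norm A = (\<Sum>\<sigma> | singular_value A \<sigma>. real (singular_value_mult A \<sigma>) * \<sigma>)"

lemma finite_singular_values: "finite {\<sigma>. singular_value (A :: real ^ 'n ^ 'm) \<sigma>}"
proof -
  define B where "B = transpose A ** A"
  have sym: "(B *v x) \<bullet> y = x \<bullet> (B *v y)" for x y
    by (simp add: B_def dot_lmul_matrix[symmetric] matrix_transpose_mul
        transpose_matrix_vector[symmetric])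
  have ex: "\<forall>\<sigma>. \<exists>v. singular_value A \<sigma> \<longrightarrow> v \<noteq> 0 \<and> B *v v = \<sigma>\<^sup>2 *\<^sub>R v"
    by (auto simp: singular_value_def B_def)
  obtain v where v: "\<And>\<sigma>. singular_value A \<sigma> \<Longrightarrow> v \<sigma> \<noteq> 0 \<and> B *v v \<sigma> = \<sigma>\<^sup>2 *\<^sub>R v \<sigma>"
    using choice[OF ex] by blast
  have orth: "v \<sigma> \<bullet> v \<tau> = 0" if "singular_value A \<sigma>" "singular_value A \<tau>" "\<sigma> \<noteq> \<tau>" for \<sigma> \<tau>
  proof -
    have "\<sigma>\<^sup>2 * (v \<sigma> \<bullet> v \<tau>) = \<tau>\<^sup>2 * (v \<sigma> \<bullet> v \<tau>)"
      using sym[of "v \<sigma>" "v \<tau>"] v[OF that(1)] v[OF that(2)] by simp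
    moreover have "\<sigma>\<^sup>2 \<noteq> \<tau>\<^sup>2"
      using that by (simp add: singular_value_def)
    ultimately show ?thesis by simp
  qed
  let ?S = "{\<sigma>. singular_value A \<sigma>}"
  have inj: "inj_on v ?S"
    using orth v by (metis (mono_tags, lifting) inj_onI inner_eq_zero_iff mem_Collect_eq)
  have "pairwise orthogonal (v ` ?S)"
    using orth by (auto simp: pairwise_def orthogonal_def)
  moreover have "0 \<notin> v ` ?S"
    using v by force
  ultimately have "finite (v ` ?S)"
    using pairwise_orthogonal_independent independent_imp_finite by blast
  then show ?thesis
    using inj by (rule finite_imageD)
qed

definition l1_norm :: "real ^ 'n ^ 'm \<Rightarrow> real" where
  "l1_norm A = (\<Sum>i\<in>UNIV. \<Sum>j\<in>UNIV. \<bar>A $ i $ j\<bar>)"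

definition proj_on :: "('m \<times> 'n) set \<Rightarrow> real ^ 'n ^ 'm \<Rightarrow> real ^ 'n ^ 'm" where
  "proj_on \<Omega> A = (\<chi> i j. if (i, j) \<in> \<Omega> then A $ i $ j else 0)"

definition spcp_feasible ::
  "('m \<times> 'n) set \<Rightarrow> real ^ 'n ^ 'm \<Rightarrow> real \<Rightarrow> (real ^ 'n ^ 'm) \<times> (real ^ 'n ^ 'm) \<Rightarrow> bool" where
  "spcp_feasible \<Omega> D \<delta> = (\<lambda>(X, S). norm (proj_on \<Omega> (X + S - D)) \<le> \<delta>)"

definition spcp_solution ::
  "real \<Rightarrow> ('m \<times> 'n) set \<Rightarrow> real ^ 'n ^ 'm \<Rightarrow> real \<Rightarrow> real ^ 'n ^ 'm \<Rightarrow> real ^ 'n ^ 'm \<Rightarrow> bool" where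
  "spcp_solution \<xi> \<Omega> D \<delta> L S \<longleftrightarrow>
     is_arg_min (\<lambda>(L, S). nuclear_norm L + \<xi> * l1_norm S) (spcp_feasible \<Omega> D \<delta>) (L, S)"

definition L_objective ::
  "real \<Rightarrow> real ^ 'n ^ 'm \<Rightarrow> real ^ 'n ^ 'm \<Rightarrow> real ^ 'n ^ 'm \<Rightarrow> real" where
  "L_objective \<rho> Y Z L = nuclear_norm L + Y \<bullet> (L - Z) + \<rho> / 2 * (norm (L - Z))\<^sup>2"

definition ZS_objective ::
  "real \<Rightarrow> real \<Rightarrow> real ^ 'n ^ 'm \<Rightarrow> real ^ 'n ^ 'm \<Rightarrow> (real ^ 'n ^ 'm) \<times> (real ^ 'n ^ 'm) \<Rightarrow> real" where
  "ZS_objective \<xi> \<rho> Y L =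
     (\<lambda>(Z, S). \<xi> * l1_norm S + (- Y) \<bullet> (Z - L) + \<rho> / 2 * (norm (Z - L))\<^sup>2)"

text \<open>
  The minimisers in both subproblems are unique, so \<^const>\<open>is_arg_min\<close> determines the iterates;
  \<open>L 0\<close> and \<open>S 0\<close> are not part of the iteration and are left unconstrained.
\<close>

definition admip ::
  "real \<Rightarrow> ('m \<times> 'n) set \<Rightarrow> real ^ 'n ^ 'm \<Rightarrow> real \<Rightarrow> (nat \<Rightarrow> real) \<Rightarrow>
   (nat \<Rightarrow> real ^ 'n ^ 'm) \<Rightarrow> (nat \<Rightarrow> real ^ 'n ^ 'm) \<Rightarrow>
   (nat \<Rightarrow> real ^ 'n ^ 'm) \<Rightarrow> (nat \<Rightarrow> real ^ 'n ^ 'm) \<Rightarrow> bool" where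
  "admip \<xi> \<Omega> D \<delta> \<rho> L Z S Y \<longleftrightarrow>
     (\<forall>k. is_arg_min (L_objective (\<rho> k) (Y k) (Z k)) (\<lambda>_. True) (L (Suc k)) \<and>
          is_arg_min (ZS_objective \<xi> (\<rho> k) (Y k) (L (Suc k))) (spcp_feasible \<Omega> D \<delta>)
            (Z (Suc k), S (Suc k)) \<and>
          Y (Suc k) = Y k + \<rho> k *\<^sub>R (L (Suc k) - Z (Suc k)))"

definition ZS_dual ::
  "real \<Rightarrow> ('m \<times> 'n) set \<Rightarrow> real ^ 'n ^ 'm \<Rightarrow> real \<Rightarrow> real \<Rightarrow>
   real ^ 'n ^ 'm \<Rightarrow> real ^ 'n ^ 'm \<Rightarrow> real \<Rightarrow> ereal" where
  "ZS_dual \<xi> \<Omega> D \<delta> \<rho> Y L \<theta> =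
     (INF (Z, S). ereal (ZS_objective \<xi> \<rho> Y L (Z, S)
        + \<theta> * (1 / 2 * (norm (proj_on \<Omega> (Z + S - D)))\<^sup>2 - \<delta>\<^sup>2 / 2)))"

definition optimal_multiplier ::
  "real \<Rightarrow> ('m \<times> 'n) set \<Rightarrow> real ^ 'n ^ 'm \<Rightarrow> real \<Rightarrow> real \<Rightarrow>
   real ^ 'n ^ 'm \<Rightarrow> real ^ 'n ^ 'm \<Rightarrow> real \<Rightarrow> bool" where
  "optimal_multiplier \<xi> \<Omega> D \<delta> \<rho> Y L \<theta> \<longleftrightarrow>
     is_arg_max (ZS_dual \<xi> \<Omega> D \<delta> \<rho> Y L) (\<lambda>\<theta>. 0 \<le> \<theta>) \<theta>"

definition lagrangian ::
  "real \<Rightarrow> ('m \<times> 'n) set \<Rightarrow> real ^ 'n ^ 'm \<Rightarrow> real \<Rightarrow> real ^ 'n ^ 'm \<Rightarrow> real ^ 'n ^ 'm \<Rightarrow>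
   real ^ 'n ^ 'm \<Rightarrow> real ^ 'n ^ 'm \<Rightarrow> real \<Rightarrow> real" where
  "lagrangian \<xi> \<Omega> D \<delta> L Z S Y \<theta> =
     nuclear_norm L + \<xi> * l1_norm S + Y \<bullet> (L - Z)
       + \<theta> / 2 * ((norm (proj_on \<Omega> (Z + S - D)))\<^sup>2 - \<delta>\<^sup>2)"

definition lagrangian_saddle_point ::
  "real \<Rightarrow> ('m \<times> 'n) set \<Rightarrow> real ^ 'n ^ 'm \<Rightarrow> real \<Rightarrow> real ^ 'n ^ 'm \<Rightarrow> real ^ 'n ^ 'm \<Rightarrow>
   real ^ 'n ^ 'm \<Rightarrow> real ^ 'n ^ 'm \<Rightarrow> real \<Rightarrow> bool" where
  "lagrangian_saddle_point \<xi> \<Omega> D \<delta> L Z S Y \<theta> \<longleftrightarrow>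
     0 \<le> \<theta> \<and>
     (\<forall>Y' \<theta>'. 0 \<le> \<theta>' \<longrightarrow> lagrangian \<xi> \<Omega> D \<delta> L Z S Y' \<theta>' \<le> lagrangian \<xi> \<Omega> D \<delta> L Z S Y \<theta>) \<and>
     (\<forall>L' Z' S'. lagrangian \<xi> \<Omega> D \<delta> L Z S Y \<theta> \<le> lagrangian \<xi> \<Omega> D \<delta> L' Z' S' Y \<theta>)"

end

theory Submission
  imports Defs
begin

text \<open>
  Let \<open>f\<close> be the nuclear norm and let \<open>h Z\<close> be the infimum of \<open>\<xi> * l1_norm S\<close> over all \<open>S\<close> for which
  \<open>(Z, S)\<close> is feasible (\<open>sparse_cost\<close>). The SPCP problem is then the minimisation of \<open>f + h\<close>, a sum
  of two convex Lipschitz functions on a Euclidean space, and an ADMIP step produces subgradients: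
  \<open>- (Y k + \<rho> k *\<^sub>R (L (Suc k) - Z k))\<close> of \<open>f\<close> at \<open>L (Suc k)\<close>, and \<open>Y (Suc k)\<close> of \<open>h\<close> at
  \<open>Z (Suc k)\<close>. Subgradients of Lipschitz functions are bounded, so the dual iterates are bounded, and
  \<open>L (Suc k) - Z (Suc k)\<close>, which is \<open>1 / \<rho> k\<close> times a difference of dual iterates, tends to \<open>0\<close>.

  Primal convergence (locale \<open>increasing_penalty_splitting\<close>). Let \<open>(x, y)\<close> be a primal and dual
  optimal pair. Monotonicity of subdifferentials shows that
  \<open>(norm (Z k - x))\<^sup>2 + (norm (Y k - y))\<^sup>2 / (\<rho> k)\<^sup>2\<close> decreases, with decrements that control
  both a nonnegative optimality gap weighted by \<open>1 / \<rho> k\<close> and \<open>(norm (Z (Suc k) - Z k))\<^sup>2\<close>. If the sum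
  of \<open>1 / \<rho> k\<close> diverges, the gap vanishes along a subsequence; a limit point of \<open>Z\<close> along it is a
  minimiser \<open>p\<close> of \<open>f + h\<close>. The same energy taken at \<open>(p, y)\<close> is decreasing and tends to \<open>0\<close> along a
  subsequence, hence tends to \<open>0\<close>. The matrices \<open>S k\<close> converge because an optimal \<open>S\<close> for given
  \<open>Z\<close> is unique (\<open>sparse_cost_minimizer_unique\<close>): the Frobenius ball is strictly convex, and a
  nonzero optimal \<open>S\<close> with slack in the constraint could be shrunk.

  Dual convergence. Strong duality for the second subproblem (Slater's condition holds as \<open>\<delta> > 0\<close>)
  gives, with \<open>residual k = proj_on \<Omega> (Z k + S k - D)\<close>, the optimality conditions
  \<open>Y (Suc k) = \<theta> k *\<^sub>R residual (Suc k)\<close>, complementary slackness, and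
  \<open>Y (Suc k) \<bullet> S (Suc k) = - (\<xi> * l1_norm (S (Suc k)))\<close>. In particular \<open>\<theta>\<close> is bounded. If
  \<open>proj_on \<Omega> (D - Ls)\<close> has norm less than \<open>\<delta>\<close>, then \<open>Ss = 0\<close>, the constraint is eventually slack and
  \<open>\<theta> k = 0\<close>. If the norm exceeds \<open>\<delta>\<close>, then \<open>Ss \<noteq> 0\<close> and the last identity determines \<open>\<theta> k\<close> as a
  quotient of convergent sequences. In both cases \<open>\<theta>\<close>, and with it \<open>Y\<close>, converges. If the sum of
  \<open>1 / (\<rho> k)\<^sup>2\<close> diverges, the summability of \<open>(norm (Z (Suc k) - Z k))\<^sup>2\<close> makes the two dual sequences
  above approach each other along a subsequence, so that \<open>- Ys\<close> is a subgradient of \<open>f\<close> at \<open>Ls\<close>;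
  the remaining saddle point conditions pass to the limit. If the norm equals \<open>\<delta>\<close>, then \<open>Ss = 0\<close>
  and the Lagrangian does not depend on the dual variables, so any limit point of the bounded
  sequence \<open>(Y k, \<theta> k)\<close> will do.
\<close>

section \<open>Singular values and the nuclear norm\<close>

text \<open>
  A maximiser \<open>v\<close> of the Rayleigh quotient on the unit sphere of \<open>W\<close> is an eigenvector: with
  \<open>c\<close> the maximal value, \<open>u = M v - c *\<^sub>R v\<close> is the direction of steepest ascent, and moving from
  \<open>v\<close> a little along \<open>u\<close> would increase the quotient unless \<open>u = 0\<close>.
\<close>

lemma selfadjoint_has_eigenvector:
  fixes M :: "'a::euclidean_space \<Rightarrow> 'a"
  assumes M: "linear M" "\<And>x y. M x \<bullet> y = x \<bullet> M y"
    and W: "subspace W" "M ` W \<subseteq> W" "W \<noteq> {0}"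
  shows "\<exists>v\<in>W. \<exists>c. v \<noteq> 0 \<and> M v = c *\<^sub>R v"
proof -
  interpret M: linear M by fact
  obtain w where w: "w \<in> W" "w \<noteq> 0"
    using W(3) subspace_0[OF W(1)] by blast
  have "sgn w \<in> W \<inter> sphere 0 1"
    using w W(1) by (simp add: sgn_div_norm subspace_scale)
  then have "W \<inter> sphere 0 1 \<noteq> {}" by blast
  moreover have "compact (W \<inter> sphere 0 1)"
    using closed_subspace[OF W(1)] by (simp add: closed_Int_compact)
  moreover have "continuous_on (W \<inter> sphere 0 1) (\<lambda>x. M x \<bullet> x)"
    by (intro continuous_intros linear_continuous_on) (simp add: M(1) linear_linear)
  ultimately obtain v where "v \<in> W \<inter> sphere 0 1" "\<forall>y\<in>W \<inter> sphere 0 1. M y \<bullet> y \<le> M v \<bullet> v"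
    using continuous_attains_sup[of "W \<inter> sphere 0 1" "\<lambda>x. M x \<bullet> x"] by blast
  then have v: "v \<in> W" "norm v = 1"
    and max: "\<And>y. y \<in> W \<Longrightarrow> norm y = 1 \<Longrightarrow> M y \<bullet> y \<le> M v \<bullet> v"
    by auto
  define c where "c = M v \<bullet> v"
  have le: "M y \<bullet> y \<le> c * (norm y)\<^sup>2" if "y \<in> W" for y
  proof (cases "y = 0")
    case False
    have "M (sgn y) \<bullet> sgn y \<le> c"
      unfolding c_def using that False W(1)
      by (intro max) (simp_all add: sgn_div_norm subspace_scale)
    moreover have "M (sgn y) \<bullet> sgn y = (M y \<bullet> y) / (norm y)\<^sup>2"
      by (simp add: sgn_div_norm M.scale power2_eq_square divide_simps)
    ultimately show ?thesis using False by (simp add: field_simps)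
  qed (simp add: M.zero)
  define u where "u = M v - c *\<^sub>R v"
  have uW: "u \<in> W" unfolding u_def using W v by (simp add: subspace_diff subspace_scale image_subset_iff)
  have "(norm u)\<^sup>2 = 0"
  proof (rule ccontr)
    assume ne: "(norm u)\<^sup>2 \<noteq> 0"
    \<comment> \<open>the bound on the second order term that makes the step \<open>t\<close> short enough\<close>
    define K where "K = \<bar>M u \<bullet> u - c * (norm u)\<^sup>2\<bar> + 1"
    define t where "t = (norm u)\<^sup>2 / K"
    have K: "K > 0" by (simp add: K_def)
    have t: "t > 0" using ne K by (simp add: t_def)
    have "M (v + t *\<^sub>R u) \<bullet> (v + t *\<^sub>R u) \<le> c * (norm (v + t *\<^sub>R u))\<^sup>2"
      by (intro le) (use W v uW in \<open>simp add: subspace_add subspace_scale\<close>)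
    moreover have "M (v + t *\<^sub>R u) \<bullet> (v + t *\<^sub>R u) = c + 2 * t * (M v \<bullet> u) + t\<^sup>2 * (M u \<bullet> u)"
      using M(2)[of u v] by (simp add: M.add M.scale inner_simps c_def power2_eq_square inner_commute algebra_simps)
    moreover have "(norm (v + t *\<^sub>R u))\<^sup>2 = 1 + 2 * t * (v \<bullet> u) + t\<^sup>2 * (norm u)\<^sup>2"
      using v(2) unfolding power2_norm_eq_inner norm_eq_1
      by (simp only: inner_simps) (simp add: inner_commute power2_eq_square algebra_simps)
    moreover have "(norm u)\<^sup>2 = M v \<bullet> u - c * (v \<bullet> u)"
      unfolding power2_norm_eq_inner by (subst (1) u_def) (simp add: inner_diff_left)
    moreover have "2 * t * n + t\<^sup>2 * (b - c * n) \<le> 0"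
      if "c + 2 * t * a + t\<^sup>2 * b \<le> c * (1 + 2 * t * d + t\<^sup>2 * n)" "n = a - c * d" for a b d n :: real
    proof -
      have "2 * t * n = 2 * t * a - c * (2 * t * d)" unfolding that(2) by (simp add: algebra_simps)
      then show ?thesis using that(1) by (simp add: algebra_simps)
    qed
    ultimately have "2 * t * (norm u)\<^sup>2 + t\<^sup>2 * (M u \<bullet> u - c * (norm u)\<^sup>2) \<le> 0"
      by metis
    then have "t * (2 * (norm u)\<^sup>2 + t * (M u \<bullet> u - c * (norm u)\<^sup>2)) \<le> 0"
      by (simp add: algebra_simps power2_eq_square)
    then have "2 * (norm u)\<^sup>2 + t * (M u \<bullet> u - c * (norm u)\<^sup>2) \<le> 0"
      using t by (simp add: mult_le_0_iff)
    moreover have "t * (- K) \<le> t * (M u \<bullet> u - c * (norm u)\<^sup>2)"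
      using t unfolding K_def by (intro mult_left_mono) arith+
    moreover have "t * (- K) = - (norm u)\<^sup>2" using K by (simp add: t_def)
    moreover have "(norm u)\<^sup>2 > 0" using ne by simp
    ultimately show False by linarith
  qed
  then have "M v = c *\<^sub>R v" by (simp add: u_def)
  with v show ?thesis by (metis norm_zero zero_neq_one)
qed

text \<open>
  The form of the spectral theorem used below: the vectors orthogonal to all eigenvectors form an
  invariant subspace, which can contain no eigenvector and is therefore trivial.
\<close>

lemma selfadjoint_eigenvectors_total:
  fixes M :: "'a::euclidean_space \<Rightarrow> 'a"
  assumes M: "linear M" "\<And>x y. M x \<bullet> y = x \<bullet> M y"
    and x: "\<And>v c. M v = c *\<^sub>R v \<Longrightarrow> x \<bullet> v = 0"
  shows "x = 0"
proof (rule ccontr)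
  assume "x \<noteq> 0"
  define W where "W = {y. \<forall>v c. M v = c *\<^sub>R v \<longrightarrow> y \<bullet> v = 0}"
  have "subspace W" by (auto simp: W_def subspace_def inner_simps)
  moreover have "M ` W \<subseteq> W" by (auto simp: W_def M(2))
  moreover have "x \<in> W" using x by (auto simp: W_def)
  ultimately obtain v c where "v \<in> W" "v \<noteq> 0" "M v = c *\<^sub>R v"
    using selfadjoint_has_eigenvector[OF M] \<open>x \<noteq> 0\<close> by blast
  then show False by (auto simp: W_def)
qed

definition orthonormal_basis :: "'a::euclidean_space set \<Rightarrow> bool" where
  "orthonormal_basis B \<longleftrightarrow>
     finite B \<and> pairwise orthogonal B \<and> (\<forall>v\<in>B. norm v = 1) \<and> span B = UNIV"

lemma orthonormal_basisD:
  assumes "orthonormal_basis B"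
  shows "finite B" "pairwise orthogonal B" "\<And>v. v \<in> B \<Longrightarrow> norm v = 1" "span B = UNIV"
  using assms by (auto simp: orthonormal_basis_def)

lemma card_orthonormal_basis:
  fixes B :: "'a::euclidean_space set"
  assumes "orthonormal_basis B"
  shows "card B = DIM('a)"
proof -
  have "0 \<notin> B" using orthonormal_basisD(3)[OF assms, of 0] by auto
  then have "independent B" by (intro pairwise_orthogonal_independent orthonormal_basisD[OF assms])
  then show ?thesis
    using dim_span_eq_card_independent[of B] orthonormal_basisD(4)[OF assms] by simp
qed

lemma orthonormal_basis_expansion:
  fixes B :: "'a::euclidean_space set"
  assumes "orthonormal_basis B"
  shows "(\<Sum>v\<in>B. (x \<bullet> v) *\<^sub>R v) = x"
proof -
  note B = orthonormal_basisD[OF assms]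
  define y where "y = x - (\<Sum>v\<in>B. (x \<bullet> v) *\<^sub>R v)"
  have "orthogonal y w" if "w \<in> B" for w
  proof -
    have "(\<Sum>v\<in>B. (x \<bullet> v) *\<^sub>R v) \<bullet> w = (\<Sum>v\<in>B. if v = w then x \<bullet> w else 0)"
      unfolding inner_sum_left
      using B(2,3) that by (intro sum.cong) (auto simp: pairwise_def orthogonal_def norm_eq_1)
    then show ?thesis using that B(1) by (simp add: y_def orthogonal_def inner_diff_left)
  qed
  then have "orthogonal y y"
    using orthogonal_to_span[of y B y] B(4) by (auto simp: orthogonal_commute)
  then show ?thesis by (simp add: orthogonal_def y_def)
qed

lemma parseval_inner:
  fixes B :: "'a::euclidean_space set"
  assumes B: "orthonormal_basis B"
  shows "x \<bullet> y = (\<Sum>v\<in>B. (x \<bullet> v) * (y \<bullet> v))"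
proof -
  have "x \<bullet> y = x \<bullet> (\<Sum>v\<in>B. (y \<bullet> v) *\<^sub>R v)"
    by (simp only: orthonormal_basis_expansion[OF B])
  then show ?thesis by (simp add: inner_sum_right mult.commute)
qed

lemma trace_inner_orthonormal:
  fixes A :: "real ^ 'n ^ 'm"
  assumes B: "orthonormal_basis B"
  shows "A \<bullet> C = (\<Sum>v\<in>B. (A *v v) \<bullet> (C *v v))"
proof -
  have "A \<bullet> C = (\<Sum>i\<in>UNIV. \<Sum>v\<in>B. (A $ i \<bullet> v) * (C $ i \<bullet> v))"
    by (subst inner_vec_def) (intro sum.cong refl parseval_inner[OF B])
  also have "\<dots> = (\<Sum>v\<in>B. (A *v v) \<bullet> (C *v v))"
    unfolding inner_vec_def[of "_ *v _"] by (subst sum.swap) (simp add: matrix_vector_mul_component)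
  finally show ?thesis .
qed

lemma gram_inner: "((transpose A ** A) *v x) \<bullet> y = (A *v x) \<bullet> (A *v y)"
  for A :: "real ^ 'n ^ 'm"
  by (simp only: matrix_vector_mul_assoc[symmetric] transpose_matrix_vector dot_lmul_matrix)

text \<open>
  Gluing orthonormal bases of the eigenspaces of \<open>transpose A ** A\<close> gives an orthonormal basis of the
  whole space. A singular value \<open>\<sigma>\<close> is \<open>norm (A *v v)\<close> for each \<open>v\<close> in the basis of its eigenspace,
  so the multiplicities in the nuclear norm are absorbed by summing over the basis.
\<close>

lemma singular_frame:
  fixes A :: "real ^ 'n ^ 'm"
  obtains B where "orthonormal_basis B" "nuclear_norm A = (\<Sum>v\<in>B. norm (A *v v))"
    "pairwise (\<lambda>v w. orthogonal (A *v v) (A *v w)) B"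
proof -
  define M where "M = (\<lambda>v. (transpose A ** A) *v v)"
  have "linear M" unfolding M_def by (rule matrix_vector_mul_linear)
  moreover have "M x \<bullet> y = x \<bullet> M y" for x y
    using gram_inner[of A x y] gram_inner[of A y x] unfolding M_def
    by (metis inner_commute)
  ultimately have M: "linear M" "\<And>x y. M x \<bullet> y = x \<bullet> M y" by blast+
  interpret M: linear M by fact
  define E where "E \<sigma> = {v. M v = \<sigma>\<^sup>2 *\<^sub>R v}" for \<sigma>
  let ?S = "{\<sigma>. singular_value A \<sigma>}"
  have subE: "subspace (E \<sigma>)" for \<sigma>
    by (auto simp: E_def subspace_def M.add M.scale M.zero scaleR_add_right)
  have "\<exists>B. B \<subseteq> E \<sigma> \<and> pairwise orthogonal B \<and> (\<forall>x\<in>B. norm x = 1) \<and> independent B \<and>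
      card B = dim (E \<sigma>) \<and> span B = E \<sigma>" for \<sigma>
    by (rule orthonormal_basis_subspace[OF subE[of \<sigma>]]) blast
  then have "\<exists>b. \<forall>\<sigma>. b \<sigma> \<subseteq> E \<sigma> \<and> pairwise orthogonal (b \<sigma>) \<and> (\<forall>x\<in>b \<sigma>. norm x = 1) \<and>
      independent (b \<sigma>) \<and> card (b \<sigma>) = dim (E \<sigma>) \<and> span (b \<sigma>) = E \<sigma>"
    by (intro choice allI)
  then obtain b where b: "\<And>\<sigma>. b \<sigma> \<subseteq> E \<sigma>" "\<And>\<sigma>. pairwise orthogonal (b \<sigma>)"
    "\<And>\<sigma> x. x \<in> b \<sigma> \<Longrightarrow> norm x = 1" "\<And>\<sigma>. independent (b \<sigma>)"
    "\<And>\<sigma>. card (b \<sigma>) = dim (E \<sigma>)" "\<And>\<sigma>. span (b \<sigma>) = E \<sigma>"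
    by blast
  have fin: "finite (b \<sigma>)" for \<sigma> using b(4) independent_imp_finite by blast
  have orthE: "orthogonal v w" if "v \<in> E \<sigma>" "w \<in> E \<tau>" "\<sigma> \<noteq> \<tau>" "0 \<le> \<sigma>" "0 \<le> \<tau>" for v w \<sigma> \<tau>
  proof -
    have "\<sigma>\<^sup>2 * (v \<bullet> w) = \<tau>\<^sup>2 * (v \<bullet> w)"
      using M(2)[of v w] that by (simp add: E_def)
    moreover have "\<sigma>\<^sup>2 \<noteq> \<tau>\<^sup>2" using that by simp
    ultimately show ?thesis by (simp add: orthogonal_def)
  qed
  have disj: "b \<sigma> \<inter> b \<tau> = {}" if "\<sigma> \<in> ?S" "\<tau> \<in> ?S" "\<sigma> \<noteq> \<tau>" for \<sigma> \<tau>
  proof (rule ccontr)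
    assume "b \<sigma> \<inter> b \<tau> \<noteq> {}"
    then obtain v where v: "v \<in> b \<sigma>" "v \<in> b \<tau>" by blast
    then have "orthogonal v v" using orthE[of v \<sigma> v \<tau>] b(1) that by (auto simp: singular_value_def)
    then show False using b(3)[OF v(1)] by (simp add: orthogonal_def)
  qed
  define B where "B = (\<Union>\<sigma>\<in>?S. b \<sigma>)"
  have B: "finite B" using fin finite_singular_values by (auto simp: B_def)
  have Borth: "pairwise orthogonal B"
    unfolding pairwise_def B_def
  proof (safe)
    fix v w \<sigma> \<tau> assume *: "singular_value A \<sigma>" "singular_value A \<tau>" "v \<in> b \<sigma>" "w \<in> b \<tau>" "v \<noteq> w"
    show "orthogonal v w"
    proof (cases "\<sigma> = \<tau>")
      case True then show ?thesis using * b(2)[of \<tau>] by (auto simp: pairwise_def)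
    next
      case False then show ?thesis using * b(1) orthE[of v \<sigma> w \<tau>] by (auto simp: singular_value_def)
    qed
  qed
  have Bnorm: "norm v = 1" if "v \<in> B" for v using that b(3) by (auto simp: B_def)
  have Bspan: "span B = UNIV"
  proof (rule ccontr)
    assume "span B \<noteq> UNIV"
    then have "span B \<subset> span UNIV" by (simp add: psubset_eq)
    then obtain x where x: "x \<noteq> 0" "\<And>y. y \<in> span B \<Longrightarrow> orthogonal x y"
      using orthogonal_to_subspace_exists_gen[of B UNIV] by auto
    have "x \<bullet> v = 0" if v: "M v = c *\<^sub>R v" for v c
    proof (cases "v = 0")
      case False
      have "c * (norm v)\<^sup>2 = (norm (A *v v))\<^sup>2"
        using gram_inner[of A v v] v by (simp add: M_def power2_norm_eq_inner)
      then have "0 \<le> c * (norm v)\<^sup>2" by simp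
      then have "c \<ge> 0" using False by (simp add: zero_le_mult_iff)
      then have "singular_value A (sqrt c)" "v \<in> E (sqrt c)"
        using v False by (auto simp: singular_value_def E_def M_def)
      then have "v \<in> span B"
        using b(6)[of "sqrt c"] span_mono[of "b (sqrt c)" B] by (auto simp: B_def)
      then show ?thesis using x(2) by (auto simp: orthogonal_def)
    qed simp
    then have "x = 0" by (intro selfadjoint_eigenvectors_total[OF M])
    with x show False by simp
  qed
  have normA: "norm (A *v v) = \<sigma>" if "v \<in> b \<sigma>" "singular_value A \<sigma>" for v \<sigma>
  proof -
    have "(norm (A *v v))\<^sup>2 = M v \<bullet> v"
      by (simp only: M_def gram_inner power2_norm_eq_inner)
    also have "\<dots> = \<sigma>\<^sup>2"
      using that b(1)[of \<sigma>] b(3)[OF that(1)] by (auto simp: E_def norm_eq_1)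
    finally show ?thesis using that by (simp add: singular_value_def)
  qed
  have "(\<Sum>v\<in>B. norm (A *v v)) = (\<Sum>\<sigma>\<in>?S. \<Sum>v\<in>b \<sigma>. norm (A *v v))"
    unfolding B_def by (intro sum.UNION_disjoint) (use finite_singular_values fin disj in auto)
  also have "\<dots> = (\<Sum>\<sigma>\<in>?S. real (singular_value_mult A \<sigma>) * \<sigma>)"
    using normA b(5) by (simp add: singular_value_mult_def E_def M_def)
  finally have nuc: "nuclear_norm A = (\<Sum>v\<in>B. norm (A *v v))" by (simp add: nuclear_norm_def)
  have "pairwise (\<lambda>v w. orthogonal (A *v v) (A *v w)) B"
    unfolding pairwise_def
  proof safe
    fix v w assume *: "v \<in> B" "w \<in> B" "v \<noteq> w"
    then obtain \<sigma> where "v \<in> E \<sigma>" using b(1) by (auto simp: B_def)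
    then have "(A *v v) \<bullet> (A *v w) = \<sigma>\<^sup>2 * (v \<bullet> w)"
      using gram_inner[of A v w] by (simp add: E_def M_def)
    then show "orthogonal (A *v v) (A *v w)"
      using * Borth by (simp add: pairwise_def orthogonal_def)
  qed
  moreover have "orthonormal_basis B"
    using B Borth Bnorm Bspan by (simp add: orthonormal_basis_def)
  ultimately show thesis using nuc that by blast
qed

text \<open>
  This lemma and the next one say that the nuclear norm is dual to the operator norm:
  \<open>nuclear_norm A\<close> is the maximum of \<open>T \<bullet> A\<close> over all contractions \<open>T\<close>. Convexity and the norm
  bounds below rest on this description.
\<close>

lemma inner_contraction_le_nuclear_norm:
  fixes A T :: "real ^ 'n ^ 'm"
  assumes "\<And>x. norm (T *v x) \<le> norm x"
  shows "T \<bullet> A \<le> nuclear_norm A"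
proof -
  obtain B where B: "orthonormal_basis B" and nuc: "nuclear_norm A = (\<Sum>v\<in>B. norm (A *v v))"
    using singular_frame[of A] by metis
  have "(T *v v) \<bullet> (A *v v) \<le> norm (A *v v)" if "v \<in> B" for v
  proof -
    have "(T *v v) \<bullet> (A *v v) \<le> norm (T *v v) * norm (A *v v)" by (rule norm_cauchy_schwarz)
    also have "\<dots> \<le> norm v * norm (A *v v)" using assms by (intro mult_right_mono) auto
    finally show ?thesis using orthonormal_basisD(3)[OF B that] by simp
  qed
  then show ?thesis
    unfolding trace_inner_orthonormal[OF B] nuc by (intro sum_mono)
qed

text \<open>
  The maximum is attained at the partial isometry of the polar decomposition, which sends \<open>v\<close> to
  \<open>sgn (A *v v)\<close>; since \<open>sgn 0 = 0\<close>, this covers the kernel of \<open>A\<close> as well.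
\<close>

lemma nuclear_norm_eq_inner_contraction:
  fixes A :: "real ^ 'n ^ 'm"
  obtains T :: "real ^ 'n ^ 'm" where "\<And>x. norm (T *v x) \<le> norm x" "T \<bullet> A = nuclear_norm A"
proof -
  obtain B where B: "orthonormal_basis B"
    and nuc: "nuclear_norm A = (\<Sum>v\<in>B. norm (A *v v))"
    and orth: "pairwise (\<lambda>v w. orthogonal (A *v v) (A *v w)) B"
    using singular_frame[of A] by metis
  define t where "t = (\<lambda>x. \<Sum>v\<in>B. (x \<bullet> v) *\<^sub>R sgn (A *v v))"
  have "linear t"
    unfolding t_def by (rule linearI) (simp_all add: inner_simps scaleR_add_left sum.distrib scaleR_sum_right)
  then have T: "matrix t *v x = t x" for x by (simp add: matrix_works)
  have "norm (t x) \<le> norm x" for x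
  proof -
    have "(norm (t x))\<^sup>2 = (\<Sum>v\<in>B. (norm ((x \<bullet> v) *\<^sub>R sgn (A *v v)))\<^sup>2)"
      unfolding t_def using orth orthonormal_basisD(1)[OF B]
      by (intro norm_sum_Pythagorean) (auto simp: pairwise_def orthogonal_def sgn_div_norm)
    also have "\<dots> \<le> (\<Sum>v\<in>B. (x \<bullet> v) * (x \<bullet> v))"
      by (intro sum_mono) (auto simp: norm_sgn power_mult_distrib power2_eq_square)
    also have "\<dots> = (norm x)\<^sup>2"
      unfolding power2_norm_eq_inner by (rule parseval_inner[OF B, symmetric])
    finally show ?thesis by simp
  qed
  moreover have "matrix t \<bullet> A = nuclear_norm A"
    unfolding trace_inner_orthonormal[OF B] nuc
  proof (intro sum.cong refl)
    fix v assume v: "v \<in> B"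
    have "t v = (\<Sum>w\<in>B. if w = v then sgn (A *v v) else 0)"
      unfolding t_def using v orthonormal_basisD(2,3)[OF B]
      by (intro sum.cong) (auto simp: pairwise_def orthogonal_def power2_norm_eq_inner[symmetric])
    then have "t v = sgn (A *v v)" using v orthonormal_basisD(1)[OF B] by simp
    then show "(matrix t *v v) \<bullet> (A *v v) = norm (A *v v)"
      by (cases "A *v v = 0") (simp_all add: T sgn_div_norm power2_norm_eq_inner[symmetric] power2_eq_square)
  qed
  ultimately show thesis by (intro that[of "matrix t"]) (simp_all add: T)
qed

lemma convex_on_nuclear_norm: "convex_on UNIV (nuclear_norm :: real ^ 'n ^ 'm \<Rightarrow> real)"
proof (rule convex_onI)
  fix t :: real and A B :: "real ^ 'n ^ 'm"
  assume t: "0 < t" "t < 1"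
  obtain T :: "real ^ 'n ^ 'm" where T: "\<And>x. norm (T *v x) \<le> norm x"
    "T \<bullet> ((1 - t) *\<^sub>R A + t *\<^sub>R B) = nuclear_norm ((1 - t) *\<^sub>R A + t *\<^sub>R B)"
    using nuclear_norm_eq_inner_contraction by blast
  have "(1 - t) * (T \<bullet> A) + t * (T \<bullet> B) \<le> (1 - t) * nuclear_norm A + t * nuclear_norm B"
    using t T(1) by (intro add_mono mult_left_mono inner_contraction_le_nuclear_norm) auto
  then show "nuclear_norm ((1 - t) *\<^sub>R A + t *\<^sub>R B) \<le> (1 - t) * nuclear_norm A + t * nuclear_norm B"
    by (simp add: T(2)[symmetric] inner_simps)
qed auto

lemma norm_matrix_vector_mult_le: "norm (A *v x) \<le> norm A * norm x" for A :: "real ^ 'n ^ 'm"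
proof -
  have "norm (A *v x) = L2_set (\<lambda>i. \<bar>A $ i \<bullet> x\<bar>) UNIV"
    unfolding norm_vec_def[of "A *v x"] by (simp add: matrix_vector_mul_component)
  also have "\<dots> \<le> L2_set (\<lambda>i. norm (A $ i) * norm x) UNIV"
    by (intro L2_set_mono) (auto simp: Cauchy_Schwarz_ineq2)
  also have "\<dots> = norm A * norm x"
    unfolding norm_vec_def[of A] by (simp add: L2_set_left_distrib)
  finally show ?thesis .
qed

text \<open>
  The Frobenius norm dominates the operator norm, so \<open>sgn A\<close> is a contraction.
\<close>

lemma norm_le_nuclear_norm: "norm A \<le> nuclear_norm A" for A :: "real ^ 'n ^ 'm"
proof -
  have "norm (sgn A *v x) \<le> norm x" for x
    using norm_matrix_vector_mult_le[of "sgn A" x] mult_right_mono[of "norm (sgn A)" 1 "norm x"]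
    by (simp add: norm_sgn split: if_splits)
  then have "sgn A \<bullet> A \<le> nuclear_norm A" by (rule inner_contraction_le_nuclear_norm)
  then show ?thesis
    by (cases "A = 0") (simp_all add: sgn_div_norm power2_norm_eq_inner[symmetric] power2_eq_square field_simps)
qed

lemma nuclear_norm_diff_le:
  "nuclear_norm A - nuclear_norm B \<le> CARD('n) * norm (A - B)" for A B :: "real ^ 'n ^ 'm"
proof -
  obtain T :: "real ^ 'n ^ 'm" where T: "\<And>x. norm (T *v x) \<le> norm x" "T \<bullet> A = nuclear_norm A"
    using nuclear_norm_eq_inner_contraction by blast
  obtain F where F: "orthonormal_basis F"
    and nuc: "nuclear_norm (A - B) = (\<Sum>v\<in>F. norm ((A - B) *v v))"
    using singular_frame[of "A - B"] by metis
  have "nuclear_norm A - nuclear_norm B \<le> T \<bullet> A - T \<bullet> B"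
    using inner_contraction_le_nuclear_norm[OF T(1), of B] T(2) by simp
  also have "\<dots> \<le> nuclear_norm (A - B)"
    using inner_contraction_le_nuclear_norm[OF T(1), of "A - B"] by (simp add: inner_diff_right)
  also have "\<dots> \<le> (\<Sum>v\<in>F. norm (A - B))"
    unfolding nuc using norm_matrix_vector_mult_le[of "A - B"] orthonormal_basisD(3)[OF F]
    by (intro sum_mono) (metis mult.right_neutral)
  finally show ?thesis by (simp add: card_orthonormal_basis[OF F])
qed

section \<open>Convex duality\<close>

lemma convex_on_norm_affine_squared:
  fixes P :: "'a::real_vector \<Rightarrow> 'b::real_inner"
  assumes "linear P"
  shows "convex_on UNIV (\<lambda>x. (norm (P x - c))\<^sup>2)"
proof (rule convex_onI)
  interpret linear P by fact
  fix t :: real and x y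
  assume t: "0 < t" "t < 1"
  define a where "a = P x - c"
  define b where "b = P y - c"
  have eq: "P ((1 - t) *\<^sub>R x + t *\<^sub>R y) - c = (1 - t) *\<^sub>R a + t *\<^sub>R b"
    by (simp add: a_def b_def add diff scale scaleR_diff_left scaleR_diff_right)
  have "(norm ((1 - t) *\<^sub>R a + t *\<^sub>R b))\<^sup>2 =
      (1 - t) * (norm a)\<^sup>2 + t * (norm b)\<^sup>2 - (1 - t) * t * (norm (a - b))\<^sup>2"
    unfolding power2_norm_eq_inner
    by (simp add: inner_simps inner_commute power2_eq_square algebra_simps)
  also have "\<dots> \<le> (1 - t) * (norm a)\<^sup>2 + t * (norm b)\<^sup>2" using t by simp
  finally show "(norm (P ((1 - t) *\<^sub>R x + t *\<^sub>R y) - c))\<^sup>2 \<le>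
      (1 - t) * (norm (P x - c))\<^sup>2 + t * (norm (P y - c))\<^sup>2"
    unfolding eq a_def b_def .
qed auto

text \<open>
  First order optimality with only the smooth part differentiated: along the segment from \<open>x\<close> to \<open>y\<close>
  the convex part changes at most linearly, while the quadratic part differs from its linearisation
  by a second order term. The linear map \<open>P\<close> selects the variables on which the penalty acts. All
  subgradients in the analysis of the iteration are obtained from this lemma.
\<close>

lemma linearize_quadratic_at_minimizer:
  fixes P :: "'a::real_vector \<Rightarrow> 'b::real_inner"
  assumes F: "convex_on C F" and P: "linear P" and x: "x \<in> C" and y: "y \<in> C"
    and min: "\<And>z. z \<in> C \<Longrightarrow> F x + v \<bullet> (P x - c) + r / 2 * (norm (P x - c))\<^sup>2
      \<le> F z + v \<bullet> (P z - c) + r / 2 * (norm (P z - c))\<^sup>2"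
  shows "F x + (v + r *\<^sub>R (P x - c)) \<bullet> P x \<le> F y + (v + r *\<^sub>R (P x - c)) \<bullet> P y"
proof -
  interpret linear P by fact
  define w where "w = P x - c"
  define d where "d = P y - P x"
  define a where "a = F y - F x + (v + r *\<^sub>R w) \<bullet> d"
  define b where "b = r / 2 * (norm d)\<^sup>2"
  have "0 \<le> a + t * b" if t: "0 < t" "t < 1" for t
  proof -
    define z where "z = (1 - t) *\<^sub>R x + t *\<^sub>R y"
    have zC: "z \<in> C"
      using F x y t unfolding z_def convex_on_def by (simp add: convexD_alt)
    have Fz: "F z \<le> (1 - t) * F x + t * F y"
      unfolding z_def using convex_onD[OF F, of t x y] t x y by simp
    have Pz: "P z - c = w + t *\<^sub>R d" by (simp add: z_def w_def d_def add diff scale scaleR_diff_left scaleR_diff_right)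
    have "F x + v \<bullet> w + r / 2 * (norm w)\<^sup>2 \<le> F z + v \<bullet> (w + t *\<^sub>R d) + r / 2 * (norm (w + t *\<^sub>R d))\<^sup>2"
      using min[OF zC] unfolding Pz w_def .
    also have "(norm (w + t *\<^sub>R d))\<^sup>2 = (norm w)\<^sup>2 + 2 * t * (w \<bullet> d) + t\<^sup>2 * (norm d)\<^sup>2"
      unfolding power2_norm_eq_inner
      by (simp add: inner_simps inner_commute power2_eq_square algebra_simps)
    finally have "0 \<le> (F z - F x) + t * ((v + r *\<^sub>R w) \<bullet> d) + t\<^sup>2 * b"
      by (simp add: b_def inner_simps algebra_simps)
    also have "\<dots> \<le> t * (a + t * b)"
      using Fz by (simp add: a_def algebra_simps power2_eq_square)
    finally show ?thesis using t by (simp add: zero_le_mult_iff)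
  qed
  then have "\<forall>\<^sub>F t in at_right 0. 0 \<le> a + t * b"
    unfolding eventually_at_right_field by (intro exI[of _ 1]) auto
  moreover have "((\<lambda>t. a + t * b) \<longlongrightarrow> a + 0 * b) (at_right 0)"
    by (intro tendsto_intros)
  ultimately have "0 \<le> a + 0 * b"
    by (intro tendsto_lowerbound[where F = "at_right (0::real)"]) auto
  then show ?thesis by (simp add: a_def d_def w_def inner_diff_right)
qed

text \<open>
  Strong duality under Slater's condition. The epigraph-like set of all \<open>(u, t)\<close> dominating some
  \<open>(G x, F x)\<close> is separated from the quadrant \<open>u \<le> 0\<close>, \<open>t < p\<close>; the Slater point rules out a
  vertical separating line, whose normal has \<open>\<beta> = 0\<close>.
\<close>

lemma lagrange_multiplier_exists:
  fixes F G :: "'a::real_vector \<Rightarrow> real"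
  assumes F: "convex_on UNIV F" and G: "convex_on UNIV G"
    and slater: "G s < 0" and min: "\<And>x. G x \<le> 0 \<Longrightarrow> p \<le> F x"
  obtains \<theta> where "0 \<le> \<theta>" "\<And>x. p \<le> F x + \<theta> * G x"
proof -
  define A where "A = {(u, t). \<exists>x. G x \<le> u \<and> F x \<le> t}"
  define B where "B = {(u::real, t). u \<le> 0 \<and> t < p}"
  have "convex A"
  proof (rule convexI, clarsimp simp: A_def)
    fix a b a' b' u v :: real and x y
    assume *: "0 \<le> u" "0 \<le> v" "u + v = 1" "G x \<le> a" "F x \<le> b" "G y \<le> a'" "F y \<le> b'"
    have "G (u *\<^sub>R x + v *\<^sub>R y) \<le> u * G x + v * G y" "F (u *\<^sub>R x + v *\<^sub>R y) \<le> u * F x + v * F y"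
      using F G * by (auto simp: convex_on_def)
    moreover have "u * G x + v * G y \<le> u * a + v * a'" "u * F x + v * F y \<le> u * b + v * b'"
      using * by (auto intro!: add_mono mult_left_mono)
    ultimately show "\<exists>z. G z \<le> u * a + v * a' \<and> F z \<le> u * b + v * b'"
      by (meson order_trans)
  qed
  moreover have "convex B"
  proof -
    have "B = {..0} \<times> {..<p}" by (auto simp: B_def)
    then show ?thesis by (simp add: convex_Times)
  qed
  moreover have "(G s, F s) \<in> A" "(0, p - 1) \<in> B" by (auto simp: A_def B_def)
  moreover have "B \<inter> A = {}"
  proof (rule equals0I, clarsimp simp: A_def B_def)
    fix u t x assume "u \<le> 0" "t < p" "G x \<le> u" "F x \<le> t"
    then show False using min[of x] by linarith
  qed
  ultimately obtain ab c where ab: "ab \<noteq> 0"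
    "\<forall>z\<in>B. ab \<bullet> z \<le> c" "\<forall>z\<in>A. ab \<bullet> z \<ge> c"
    using separating_hyperplane_sets[of B A] by blast
  obtain \<alpha> \<beta> where [simp]: "ab = (\<alpha>, \<beta>)" by (cases ab)
  have B: "\<alpha> * u + \<beta> * t \<le> c" if "u \<le> 0" "t < p" for u t
    using ab(2) that by (auto simp: B_def)
  have A: "c \<le> \<alpha> * u + \<beta> * t" if "G x \<le> u" "F x \<le> t" for u t x
    using ab(3) that by (auto simp: A_def)
  have \<alpha>: "0 \<le> \<alpha>"
  proof (rule ccontr)
    assume "\<not> 0 \<le> \<alpha>"
    define u where "u = max (G s) ((c - \<beta> * F s - 1) / \<alpha>)"
    have "\<alpha> * u \<le> c - \<beta> * F s - 1" using \<open>\<not> 0 \<le> \<alpha>\<close> by (simp add: u_def field_simps max_def)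
    moreover have "c \<le> \<alpha> * u + \<beta> * F s" by (rule A[of s]) (simp_all add: u_def)
    ultimately show False by simp
  qed
  have \<beta>: "0 \<le> \<beta>"
  proof (rule ccontr)
    assume "\<not> 0 \<le> \<beta>"
    define t where "t = max (F s) ((c - \<alpha> * G s - 1) / \<beta>)"
    have "\<beta> * t \<le> c - \<alpha> * G s - 1" using \<open>\<not> 0 \<le> \<beta>\<close> by (simp add: t_def field_simps max_def)
    moreover have "c \<le> \<alpha> * G s + \<beta> * t" by (rule A[of s]) (simp_all add: t_def)
    ultimately show False by simp
  qed
  have pc: "\<beta> * p \<le> c"
  proof (rule field_le_epsilon)
    fix e :: real assume "0 < e"
    define t where "t = p - e / (\<beta> + 1)"
    have "\<beta> * t \<le> c" using B[of 0 t] \<open>0 < e\<close> \<beta> by (simp add: t_def)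
    moreover have "\<beta> * (e / (\<beta> + 1)) \<le> e" using \<open>0 < e\<close> \<beta> by (simp add: field_simps)
    ultimately show "\<beta> * p \<le> c + e" by (simp add: t_def algebra_simps)
  qed
  have "\<beta> \<noteq> 0"
  proof
    assume "\<beta> = 0"
    with ab(1) \<alpha> have "\<alpha> > 0" by (simp add: zero_prod_def)
    then have "\<alpha> * G s < 0" using slater by (simp add: mult_pos_neg)
    then show False using A[of s "G s" "F s"] pc \<open>\<beta> = 0\<close> by simp
  qed
  with \<beta> have \<beta>': "\<beta> > 0" by simp
  show thesis
  proof
    show "0 \<le> \<alpha> / \<beta>" using \<alpha> \<beta> by simp
    fix x
    have "\<beta> * p \<le> \<alpha> * G x + \<beta> * F x" using pc A[of x "G x" "F x"] by simp
    then show "p \<le> F x + \<alpha> / \<beta> * G x" using \<beta>' by (simp add: field_simps)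
  qed
qed

definition subgradient :: "('a::real_inner \<Rightarrow> real) \<Rightarrow> 'a \<Rightarrow> 'a \<Rightarrow> bool" where
  "subgradient f x y \<longleftrightarrow> (\<forall>z. f x + y \<bullet> (z - x) \<le> f z)"

lemma subgradientD: "subgradient f x y \<Longrightarrow> f x + y \<bullet> (z - x) \<le> f z"
  by (simp add: subgradient_def)

lemma subgradient_monotone:
  assumes "subgradient f x u" "subgradient f y v"
  shows "0 \<le> (u - v) \<bullet> (x - y)"
  using subgradientD[OF assms(1), of y] subgradientD[OF assms(2), of x]
  by (simp add: inner_simps algebra_simps)

lemma subgradient_norm_le:
  assumes "C-lipschitz_on UNIV f" "subgradient f x y"
  shows "norm y \<le> C"
proof -
  have "y \<bullet> y \<le> f (x + y) - f x" using subgradientD[OF assms(2), of "x + y"] by simp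
  also have "\<dots> \<le> C * norm y"
    using lipschitz_onD[OF assms(1), of "x + y" x] by (simp add: dist_norm)
  finally have "norm y * norm y \<le> C * norm y" by (simp add: power2_norm_eq_inner[symmetric] power2_eq_square)
  then show ?thesis using lipschitz_on_nonneg[OF assms(1)] by (cases "y = 0") auto
qed

lemma subgradient_limit:
  assumes "continuous_on UNIV f" "\<And>k. subgradient f (x k) (y k)" "x \<longlonglongrightarrow> xl" "y \<longlonglongrightarrow> yl"
  shows "subgradient f xl yl"
  unfolding subgradient_def
proof
  fix z
  have "(\<lambda>k. f (x k) + y k \<bullet> (z - x k)) \<longlonglongrightarrow> f xl + yl \<bullet> (z - xl)"
    by (intro tendsto_intros assms continuous_on_tendsto_compose[OF assms(1)]) auto
  then show "f xl + yl \<bullet> (z - xl) \<le> f z"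
    using subgradientD[OF assms(2)] by (intro LIMSEQ_le_const2) auto
qed

text \<open>
  Fermat's rule together with the subdifferential sum rule: at a minimiser of \<open>f + h\<close>, the epigraph
  of \<open>f\<close> and the hypograph of \<open>f x + h x - h z\<close> touch without crossing, and a separating hyperplane is
  the graph of an affine function that supports both.
\<close>

lemma subgradient_of_sum_minimizer:
  fixes f h :: "'a::euclidean_space \<Rightarrow> real"
  assumes f: "convex_on UNIV f" and h: "convex_on UNIV h"
    and min: "\<And>z. f x + h x \<le> f z + h z"
  obtains y where "subgradient f x (- y)" "subgradient h x y"
proof -
  define A where "A = {(z, t). f z < t}"
  define B where "B = {(z, t). t \<le> f x + h x - h z}"
  have "convex A"
  proof (rule convexI, clarsimp simp: A_def)
    fix z z' :: 'a and t t' u v :: real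
    assume *: "f z < t" "f z' < t'" "0 \<le> u" "0 \<le> v" "u + v = 1"
    have "f (u *\<^sub>R z + v *\<^sub>R z') \<le> u * f z + v * f z'" using f * by (auto simp: convex_on_def)
    also have "\<dots> < u * t + v * t'"
      using * by (cases "u = 0") (auto intro!: add_less_le_mono mult_left_mono)
    finally show "f (u *\<^sub>R z + v *\<^sub>R z') < u * t + v * t'" .
  qed
  moreover have "convex B"
  proof (rule convexI, clarsimp simp: B_def)
    fix z z' :: 'a and t t' u v :: real
    assume *: "t \<le> f x + h x - h z" "t' \<le> f x + h x - h z'" "0 \<le> u" "0 \<le> v" "u + v = 1"
    have "u * t + v * t' \<le> u * (f x + h x - h z) + v * (f x + h x - h z')"
      using * by (intro add_mono mult_left_mono) auto
    also have "\<dots> = (u + v) * (f x + h x) - (u * h z + v * h z')" by (simp add: algebra_simps)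
    also have "\<dots> \<le> f x + h x - h (u *\<^sub>R z + v *\<^sub>R z')"
      using h *(3-5) unfolding convex_on_def by (simp add: algebra_simps)
    finally show "u * t + v * t' \<le> f x + h x - h (u *\<^sub>R z + v *\<^sub>R z')" .
  qed
  moreover have "(x, f x + 1) \<in> A" "(x, f x) \<in> B" by (auto simp: A_def B_def)
  moreover have "B \<inter> A = {}"
  proof (rule equals0I, clarsimp simp: A_def B_def)
    fix z t assume "t \<le> f x + h x - h z" "f z < t"
    then show False using min[of z] by linarith
  qed
  ultimately obtain ab c where ab: "ab \<noteq> 0"
    "\<forall>z\<in>B. ab \<bullet> z \<le> c" "\<forall>z\<in>A. ab \<bullet> z \<ge> c"
    using separating_hyperplane_sets[of B A] by blast
  obtain a \<beta> where [simp]: "ab = (a, \<beta>)" by (cases ab)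
  have B: "a \<bullet> z + \<beta> * t \<le> c" if "t \<le> f x + h x - h z" for z t
    using ab(2) that by (auto simp: B_def)
  have A: "c \<le> a \<bullet> z + \<beta> * t" if "f z < t" for z t
    using ab(3) that by (auto simp: A_def)
  have "0 \<le> \<beta>" using B[of "f x" x] A[of x "f x + 1"] by (simp add: algebra_simps)
  moreover have "\<beta> \<noteq> 0"
  proof
    assume 0: "\<beta> = 0"
    have "a \<bullet> x \<le> c" using B[of "f x" x] 0 by simp
    moreover have "c \<le> a \<bullet> (x - a)" using A[of "x - a" "f (x - a) + 1"] 0 by simp
    ultimately have "a \<bullet> a \<le> 0" by (simp add: inner_diff_right)
    then have "a = 0" by (metis inner_eq_zero_iff inner_ge_zero order_antisym)
    with 0 ab(1) show False by (simp add: zero_prod_def)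
  qed
  ultimately have \<beta>: "0 < \<beta>" by simp
  have A': "c \<le> a \<bullet> z + \<beta> * f z" for z
  proof (rule field_le_epsilon)
    fix e :: real assume "0 < e"
    then show "c \<le> a \<bullet> z + \<beta> * f z + e"
      using A[of z "f z + e / \<beta>"] \<beta> by (simp add: algebra_simps)
  qed
  have c: "c = a \<bullet> x + \<beta> * f x" using A'[of x] B[of "f x" x] by simp
  show thesis
  proof (rule that[of "a /\<^sub>R \<beta>"])
    have "\<beta> * f x + - (a \<bullet> (z - x)) \<le> \<beta> * f z" for z
      using A'[of z] c by (simp add: inner_diff_right)
    then show "subgradient f x (- (a /\<^sub>R \<beta>))"
      using \<beta> by (auto simp: subgradient_def divide_inverse[symmetric] field_simps)
    have "\<beta> * h x + a \<bullet> (z - x) \<le> \<beta> * h z" for z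
      using B[of "f x + h x - h z" z] c by (simp add: inner_diff_right algebra_simps)
    then show "subgradient h x (a /\<^sub>R \<beta>)"
      using \<beta> by (auto simp: subgradient_def divide_inverse[symmetric] field_simps)
  qed
qed

section \<open>Convergence of increasing penalty splitting\<close>

text \<open>
  A lower bound \<open>e \<le> a k\<close> valid from some index on would bound the divergent series of the weights by
  \<open>1 / e\<close> times a convergent one. Both divergence hypotheses on the penalties enter through this
  lemma.
\<close>

lemma vanishing_subseq_of_weighted_sum:
  fixes w a :: "nat \<Rightarrow> real"
  assumes w: "\<And>k. 0 \<le> w k" "\<not> summable w" and a: "\<And>k. 0 \<le> a k"
    and bound: "\<And>n. (\<Sum>k<n. w k * a k) \<le> b"
  obtains r :: "nat \<Rightarrow> nat" where "strict_mono r" "(\<lambda>n. a (r n)) \<longlonglongrightarrow> 0"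
proof -
  have sm: "summable (\<lambda>k. w k * a k)"
    using w a bound by (intro summableI_nonneg_bounded[where x = b]) auto
  have ex: "\<exists>k>m. a k < e" if "0 < e" for e m
  proof (rule ccontr)
    assume "\<not> ?thesis"
    then have le: "e \<le> a k" if "k \<ge> Suc m" for k using that by (meson Suc_le_eq not_le)
    have "norm (w k) \<le> 1 / e * (w k * a k)" if "k \<ge> Suc m" for k
      using w(1)[of k] mult_left_mono[OF le[OF that] w(1)[of k]] \<open>0 < e\<close> by (simp add: field_simps)
    then have "summable w"
      by (rule summable_comparison_test'[OF summable_mult[OF sm]])
    with w(2) show False ..
  qed
  have "\<exists>r. \<forall>n. a (r n) < 1 / real (Suc n) \<and> r n < r (Suc n)"
  proof (rule dependent_nat_choice)
    show "\<exists>x. a x < 1 / real (Suc 0)" using ex[of 1 0] by auto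
    show "\<exists>y. a y < 1 / real (Suc (Suc n)) \<and> x < y" for x n
      using ex[of "1 / real (Suc (Suc n))" x] by auto
  qed
  then obtain r where r: "\<And>n. a (r n) < 1 / real (Suc n)" "\<And>n. r n < r (Suc n)" by blast
  show thesis
  proof
    show "strict_mono r" using r(2) by (simp add: strict_mono_Suc_iff)
    have lim: "(\<lambda>n. 1 / real (Suc n)) \<longlonglongrightarrow> 0" using LIMSEQ_inverse_real_of_nat by (simp add: inverse_eq_divide)
    show "(\<lambda>n. a (r n)) \<longlonglongrightarrow> 0"
      by (rule tendsto_sandwich[OF _ _ tendsto_const lim]) (use a r(1)[THEN less_imp_le] in auto)
  qed
qed

lemma sum_le_of_telescoping:
  fixes V a :: "nat \<Rightarrow> real"
  assumes "\<And>k. V (Suc k) + a k \<le> V k" "\<And>k. 0 \<le> V k"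
  shows "(\<Sum>k<n. a k) \<le> V 0"
proof -
  have "V n + (\<Sum>k<n. a k) \<le> V 0"
  proof (induction n)
    case (Suc n) then show ?case using assms(1)[of n] by simp
  qed simp
  then show ?thesis using assms(2)[of n] by linarith
qed

text \<open>
  The optimality conditions of the problem of minimising \<open>f x + h z\<close> subject to \<open>x = z\<close>, with
  multiplier \<open>y\<close>.
\<close>

definition saddle_pair :: "('a::real_inner \<Rightarrow> real) \<Rightarrow> ('a \<Rightarrow> real) \<Rightarrow> 'a \<Rightarrow> 'a \<Rightarrow> bool" where
  "saddle_pair f h x y \<longleftrightarrow> subgradient f x (- y) \<and> subgradient h x y"

lemma saddle_pair_minimizes:
  assumes "saddle_pair f h x y"
  shows "f x + h x \<le> f z + h z"
  using assms subgradientD[of f x "- y" z] subgradientD[of h x y z] by (auto simp: saddle_pair_def)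

text \<open>
  An optimal multiplier serves every minimiser: at \<open>p\<close> both affine lower bounds given by \<open>(x, y)\<close>
  must be equalities.
\<close>

lemma saddle_pair_at_other_minimizer:
  assumes xy: "saddle_pair f h x y" and le: "f p + h p \<le> f x + h x"
  shows "saddle_pair f h p y"
proof -
  note sub = subgradientD[of f x "- y"] subgradientD[of h x y]
  have "f p = f x - y \<bullet> (p - x)" "h p = h x + y \<bullet> (p - x)"
    using sub[of p] xy le by (auto simp: saddle_pair_def)
  then show ?thesis
    using sub xy by (auto simp: saddle_pair_def subgradient_def inner_diff_right)
qed

text \<open>
  An abstract form of the iteration, in which the two minimisation steps are represented by the
  subgradient inclusions that they imply.
\<close>

locale increasing_penalty_splitting =
  fixes f h :: "'a::euclidean_space \<Rightarrow> real" and \<rho> :: "nat \<Rightarrow> real" and L Z Y :: "nat \<Rightarrow> 'a"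
    and K :: real
  assumes f_lipschitz: "K-lipschitz_on UNIV f" and h_lipschitz: "K-lipschitz_on UNIV h"
    and saddle_exists: "\<exists>x y. saddle_pair f h x y"
    and \<rho>_pos: "0 < \<rho> k" and \<rho>_mono: "\<rho> k \<le> \<rho> (Suc k)" and \<rho>_lim: "filterlim \<rho> at_top sequentially"
    and L_step: "subgradient f (L (Suc k)) (- (Y k + \<rho> k *\<^sub>R (L (Suc k) - Z k)))"
    and Z_step: "subgradient h (Z (Suc k)) (Y (Suc k))"
    and Y_step: "Y (Suc k) = Y k + \<rho> k *\<^sub>R (L (Suc k) - Z (Suc k))"
begin

text \<open>
  The multiplier estimate after the first half step. It is \<open>predicted_dual\<close>, not \<open>Y\<close>, whose negative
  is a subgradient of \<open>f\<close>; the two differ by the penalised movement of \<open>Z\<close>.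
\<close>

definition predicted_dual :: "nat \<Rightarrow> 'a" where
  "predicted_dual k = Y k + \<rho> k *\<^sub>R (L (Suc k) - Z k)"

lemma predicted_dual_eq: "predicted_dual k = Y (Suc k) + \<rho> k *\<^sub>R (Z (Suc k) - Z k)"
  by (simp add: predicted_dual_def Y_step algebra_simps)

lemma L_subgradient: "subgradient f (L (Suc k)) (- predicted_dual k)"
  using L_step by (simp add: predicted_dual_def)

lemma dual_bounded: "norm (Y (Suc k)) \<le> K"
  using subgradient_norm_le[OF h_lipschitz Z_step] .

lemma predicted_dual_bounded: "norm (predicted_dual k) \<le> K"
  using subgradient_norm_le[OF f_lipschitz L_subgradient] by simp

lemma continuous_f: "continuous_on UNIV f" and continuous_h: "continuous_on UNIV h"
  using f_lipschitz h_lipschitz by (auto intro: lipschitz_on_continuous_on)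

lemma residual_eq: "L (Suc k) - Z (Suc k) = (1 / \<rho> k) *\<^sub>R (Y (Suc k) - Y k)"
  using \<rho>_pos[of k] by (simp add: Y_step)

lemma residual_tendsto_zero: "(\<lambda>k. L k - Z k) \<longlonglongrightarrow> 0"
proof -
  have "(\<lambda>k. L (Suc (Suc k)) - Z (Suc (Suc k))) \<longlonglongrightarrow> 0"
  proof (rule Lim_null_comparison)
    have "norm (Y (Suc (Suc k)) - Y (Suc k)) \<le> 2 * K" for k
      using norm_triangle_ineq4[of "Y (Suc (Suc k))" "Y (Suc k)"] dual_bounded[of k] dual_bounded[of "Suc k"]
      by simp
    then show "\<forall>\<^sub>F k in sequentially. norm (L (Suc (Suc k)) - Z (Suc (Suc k))) \<le> 2 * K / \<rho> (Suc k)"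
      using \<rho>_pos by (auto simp: residual_eq divide_right_mono less_imp_le)
    have "filterlim (\<lambda>k. \<rho> (Suc k)) at_top sequentially"
      using \<rho>_lim by (rule filterlim_compose[OF _ filterlim_Suc])
    then show "(\<lambda>k. 2 * K / \<rho> (Suc k)) \<longlonglongrightarrow> 0"
      by (intro tendsto_divide_0[OF tendsto_const] filterlim_at_top_imp_at_infinity)
  qed
  then show ?thesis
    by (intro LIMSEQ_imp_Suc[of "\<lambda>k. L k - Z k"] LIMSEQ_imp_Suc[of "\<lambda>k. L (Suc k) - Z (Suc k)"])
qed

definition energy :: "'a \<Rightarrow> 'a \<Rightarrow> nat \<Rightarrow> real" where
  "energy x y k = (norm (Z k - x))\<^sup>2 + (norm (Y k - y))\<^sup>2 / (\<rho> k)\<^sup>2"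

text \<open>
  The sum of the two monotonicity terms that compare the iterate with the saddle pair. When it
  vanishes in the limit, the limit of the iterates is optimal.
\<close>

definition saddle_gap :: "'a \<Rightarrow> 'a \<Rightarrow> nat \<Rightarrow> real" where
  "saddle_gap x y k =
     (Y (Suc k) - y) \<bullet> (Z (Suc k) - x) + (y - predicted_dual k) \<bullet> (L (Suc k) - x)"

lemma saddle_gap_nonneg:
  assumes "saddle_pair f h x y"
  shows "0 \<le> saddle_gap x y k"
  using subgradient_monotone[OF Z_step[of k], of x y]
    subgradient_monotone[OF L_subgradient[of k], of x "- y"] assms
  by (auto simp: saddle_gap_def saddle_pair_def)

text \<open>
  After dividing the dual quantities by \<open>\<rho> j\<close>, the claim for the fixed penalty \<open>\<rho> j\<close> is an algebraic
  identity up to two nonnegative terms, one of them nonnegative by monotonicity of the subdifferential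
  of \<open>h\<close> at consecutive \<open>Z\<close>. Replacing \<open>\<rho> j\<close> by the larger \<open>\<rho> (Suc j)\<close> only lowers the energy. The
  indices start at \<open>1\<close> because \<open>Y 0\<close> and \<open>Z 0\<close> are arbitrary, so \<open>Y 0\<close> need not be a subgradient.
\<close>

lemma energy_decrease:
  assumes "saddle_pair f h x y"
  shows "energy x y (Suc (Suc k)) + (2 / \<rho> (Suc k) * saddle_gap x y (Suc k) +
    (norm (Z (Suc (Suc k)) - Z (Suc k)))\<^sup>2) \<le> energy x y (Suc k)"
proof -
  define j where "j = Suc k"
  define z where "z = Z j - x"
  define z' where "z' = Z (Suc j) - x"
  define a where "a = (1 / \<rho> j) *\<^sub>R (Y j - y)"
  define a' where "a' = (1 / \<rho> j) *\<^sub>R (Y (Suc j) - y)"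
  have r: "\<rho> j > 0" by (rule \<rho>_pos)
  have Yy: "Y j - y = \<rho> j *\<^sub>R a" "Y (Suc j) - y = \<rho> j *\<^sub>R a'" using r by (simp_all add: a_def a'_def)
  have Zz: "Z (Suc j) - Z j = z' - z" by (simp add: z_def z'_def)
  have Lx: "L (Suc j) - x = z' + (a' - a)"
    using residual_eq[of j] by (simp add: z'_def a_def a'_def scaleR_diff_right algebra_simps)
  have Py: "y - predicted_dual j = - (\<rho> j *\<^sub>R (a' + (z' - z)))"
    using Yy(2) by (simp add: predicted_dual_eq Zz algebra_simps)
  have "saddle_gap x y j = \<rho> j * (a' \<bullet> z' - (a' + (z' - z)) \<bullet> (z' + (a' - a)))"
    unfolding saddle_gap_def Lx Py Yy(2) z'_def[symmetric]
    by (simp only: inner_scaleR_left inner_minus_left right_diff_distrib)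
  then have gap: "2 / \<rho> j * saddle_gap x y j = 2 * (a' \<bullet> z' - (a' + (z' - z)) \<bullet> (z' + (a' - a)))"
    using r by simp
  have mono: "0 \<le> (z' - z) \<bullet> (a' - a)"
  proof -
    have "0 \<le> (Y (Suc j) - Y j) \<bullet> (Z (Suc j) - Z j)"
      using subgradient_monotone[OF Z_step[of j] Z_step[of k]] by (simp add: j_def)
    also have "Y (Suc j) - Y j = \<rho> j *\<^sub>R (a' - a)" unfolding scaleR_diff_right Yy[symmetric] by simp
    finally show ?thesis using r by (simp add: Zz zero_le_mult_iff inner_commute)
  qed
  have "(norm z')\<^sup>2 + (norm a')\<^sup>2 + 2 * (a' \<bullet> z' - (a' + (z' - z)) \<bullet> (z' + (a' - a))) +
      (norm (z' - z))\<^sup>2 + (norm (a' - a))\<^sup>2 + 2 * ((z' - z) \<bullet> (a' - a)) = (norm z)\<^sup>2 + (norm a)\<^sup>2"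
    unfolding power2_norm_eq_inner by (simp add: inner_simps inner_commute algebra_simps)
  then have "(norm z')\<^sup>2 + (norm a')\<^sup>2 + 2 / \<rho> j * saddle_gap x y j + (norm (z' - z))\<^sup>2 \<le> (norm z)\<^sup>2 + (norm a)\<^sup>2"
    using mono zero_le_power2[of "norm (a' - a)"] unfolding gap by linarith
  moreover have "(norm z)\<^sup>2 + (norm a)\<^sup>2 = energy x y j"
    using r by (simp add: energy_def z_def a_def power_mult_distrib power_divide)
  moreover have "energy x y (Suc j) \<le> (norm z')\<^sup>2 + (norm a')\<^sup>2"
  proof -
    have "(\<rho> j)\<^sup>2 \<le> (\<rho> (Suc j))\<^sup>2" using r \<rho>_mono by (simp add: power_mono)
    then have "(norm (Y (Suc j) - y))\<^sup>2 / (\<rho> (Suc j))\<^sup>2 \<le> (norm (Y (Suc j) - y))\<^sup>2 / (\<rho> j)\<^sup>2"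
      using r \<rho>_pos[of "Suc j"] by (intro divide_left_mono mult_pos_pos) auto
    then show ?thesis using r by (simp add: energy_def z'_def a'_def power_mult_distrib power_divide)
  qed
  ultimately show ?thesis using Zz by (simp add: j_def)
qed

lemma energy_nonneg: "0 \<le> energy x y k"
  by (simp add: energy_def)

lemma decseq_energy:
  assumes "saddle_pair f h x y"
  shows "decseq (\<lambda>k. energy x y (Suc k))"
proof (rule decseq_SucI)
  fix k
  have "0 \<le> 2 / \<rho> (Suc k) * saddle_gap x y (Suc k)"
    using saddle_gap_nonneg[OF assms] \<rho>_pos[of "Suc k"] by simp
  then show "energy x y (Suc (Suc k)) \<le> energy x y (Suc k)"
    using energy_decrease[OF assms, of k] zero_le_power2[of "norm (Z (Suc (Suc k)) - Z (Suc k))"] by linarith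
qed

text \<open>
  The energy decrements bound the sum of the gaps with weights \<open>2 / \<rho> k\<close>.
\<close>

lemma saddle_gap_vanishes_along_subseq:
  assumes xy: "saddle_pair f h x y" and div: "\<not> summable (\<lambda>k. 1 / \<rho> k)"
  obtains r :: "nat \<Rightarrow> nat" where "strict_mono r" "(\<lambda>n. saddle_gap x y (Suc (r n))) \<longlonglongrightarrow> 0"
proof (rule vanishing_subseq_of_weighted_sum)
  show "\<not> summable (\<lambda>k. 1 / \<rho> (Suc k))" using div by (simp add: summable_Suc_iff[of "\<lambda>k. 1 / \<rho> k"])
  show "0 \<le> 1 / \<rho> (Suc k)" for k using \<rho>_pos[of "Suc k"] by simp
  show "0 \<le> saddle_gap x y (Suc k)" for k by (rule saddle_gap_nonneg[OF xy])
  have "energy x y (Suc (Suc k)) + 2 / \<rho> (Suc k) * saddle_gap x y (Suc k) \<le> energy x y (Suc k)" for k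
    using energy_decrease[OF xy, of k] zero_le_power2[of "norm (Z (Suc (Suc k)) - Z (Suc k))"] by linarith
  from sum_le_of_telescoping[of "\<lambda>k. energy x y (Suc k)", OF this energy_nonneg]
  have "2 * (\<Sum>k<n. 1 / \<rho> (Suc k) * saddle_gap x y (Suc k)) \<le> energy x y (Suc 0)" for n
    by (simp add: sum_distrib_left)
  then show "(\<Sum>k<n. 1 / \<rho> (Suc k) * saddle_gap x y (Suc k)) \<le> energy x y (Suc 0) / 2" for n
    by (simp add: field_simps)
qed (use that in auto)

text \<open>
  The gap between the two dual sequences is \<open>\<rho> k *\<^sub>R (Z (Suc k) - Z k)\<close>, so its squared norm is
  summable with weights \<open>1 / (\<rho> k)\<^sup>2\<close>.
\<close>

lemma predicted_dual_gap_vanishes_along_subseq: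
  assumes div: "\<not> summable (\<lambda>k. 1 / (\<rho> k)\<^sup>2)"
  obtains r :: "nat \<Rightarrow> nat" where "strict_mono r"
    "(\<lambda>n. predicted_dual (Suc (r n)) - Y (Suc (Suc (r n)))) \<longlonglongrightarrow> 0"
proof -
  obtain x y where xy: "saddle_pair f h x y" using saddle_exists by blast
  define a where "a k = (norm (predicted_dual (Suc k) - Y (Suc (Suc k))))\<^sup>2" for k
  have a: "1 / (\<rho> (Suc k))\<^sup>2 * a k = (norm (Z (Suc (Suc k)) - Z (Suc k)))\<^sup>2" for k
    using \<rho>_pos[of "Suc k"] by (simp add: a_def predicted_dual_eq power_mult_distrib)
  obtain r :: "nat \<Rightarrow> nat" where r: "strict_mono r" "(\<lambda>n. a (r n)) \<longlonglongrightarrow> 0"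
  proof (rule vanishing_subseq_of_weighted_sum)
    show "\<not> summable (\<lambda>k. 1 / (\<rho> (Suc k))\<^sup>2)"
      using div by (simp add: summable_Suc_iff[of "\<lambda>k. 1 / (\<rho> k)\<^sup>2"])
    have "0 \<le> 2 / \<rho> (Suc k) * saddle_gap x y (Suc k)" for k
      using saddle_gap_nonneg[OF xy] \<rho>_pos[of "Suc k"] by simp
    then have "energy x y (Suc (Suc k)) + 1 / (\<rho> (Suc k))\<^sup>2 * a k \<le> energy x y (Suc k)" for k
      using energy_decrease[OF xy, of k] unfolding a by (smt (verit))
    from sum_le_of_telescoping[of "\<lambda>k. energy x y (Suc k)", OF this energy_nonneg]
    show "(\<Sum>k<n. 1 / (\<rho> (Suc k))\<^sup>2 * a k) \<le> energy x y (Suc 0)" for n .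
  qed (auto simp: a_def)
  have "(\<lambda>n. sqrt (a (r n))) \<longlonglongrightarrow> sqrt 0" by (intro tendsto_real_sqrt r)
  then have "(\<lambda>n. predicted_dual (Suc (r n)) - Y (Suc (Suc (r n)))) \<longlonglongrightarrow> 0"
    unfolding a_def by (simp add: tendsto_norm_zero_iff)
  with r that show thesis by blast
qed

text \<open>
  The energy centred at \<open>(p, y)\<close> decreases, and it tends to \<open>0\<close> along the subsequence: its dual part
  is a bounded quantity divided by \<open>(\<rho> k)\<^sup>2\<close>.
\<close>

lemma tendsto_of_subseq_tendsto:
  assumes py: "saddle_pair f h p y" and r: "strict_mono (r :: nat \<Rightarrow> nat)"
    and lim: "(\<lambda>n. Z (Suc (r n))) \<longlonglongrightarrow> p"
  shows "Z \<longlonglongrightarrow> p"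
proof -
  obtain c where c: "(\<lambda>k. energy p y (Suc k)) \<longlonglongrightarrow> c"
    by (rule decseq_convergent[OF decseq_energy[OF py], of 0]) (auto simp: energy_nonneg)
  have \<rho>': "filterlim (\<lambda>n. (\<rho> (Suc (r n)))\<^sup>2) at_infinity sequentially"
    by (intro filterlim_at_top_imp_at_infinity filterlim_pow_at_top filterlim_compose[OF \<rho>_lim]
        filterlim_compose[OF filterlim_Suc] filterlim_subseq r) simp
  have "(\<lambda>n. (norm (Y (Suc (r n)) - y))\<^sup>2 / (\<rho> (Suc (r n)))\<^sup>2) \<longlonglongrightarrow> 0"
  proof (rule Lim_null_comparison)
    have "norm (Y (Suc (r n)) - y) \<le> K + norm y" for n
      using norm_triangle_ineq4[of "Y (Suc (r n))" y] dual_bounded[of "r n"] by simp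
    then show "\<forall>\<^sub>F n in sequentially. norm ((norm (Y (Suc (r n)) - y))\<^sup>2 / (\<rho> (Suc (r n)))\<^sup>2)
        \<le> (K + norm y)\<^sup>2 / (\<rho> (Suc (r n)))\<^sup>2"
      by (intro always_eventually allI) (simp add: divide_right_mono power_mono)
    show "(\<lambda>n. (K + norm y)\<^sup>2 / (\<rho> (Suc (r n)))\<^sup>2) \<longlonglongrightarrow> 0"
      by (intro tendsto_divide_0[OF tendsto_const] \<rho>')
  qed
  moreover have "(\<lambda>n. (norm (Z (Suc (r n)) - p))\<^sup>2) \<longlonglongrightarrow> (norm (p - p))\<^sup>2"
    by (intro tendsto_intros lim)
  ultimately have "(\<lambda>n. energy p y (Suc (r n))) \<longlonglongrightarrow> (norm (p - p))\<^sup>2 + 0"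
    unfolding energy_def by (intro tendsto_add)
  moreover have "(\<lambda>n. energy p y (Suc (r n))) \<longlonglongrightarrow> c"
    using LIMSEQ_subseq_LIMSEQ[OF c r] by (simp add: o_def)
  ultimately have "c = (norm (p - p))\<^sup>2 + 0" by (intro LIMSEQ_unique)
  then have "c = 0" by simp
  have "(\<lambda>k. (norm (Z (Suc k) - p))\<^sup>2) \<longlonglongrightarrow> 0"
    by (rule tendsto_sandwich[OF _ _ tendsto_const c[unfolded \<open>c = 0\<close>]]) (auto simp: energy_def)
  then have "(\<lambda>k. sqrt ((norm (Z (Suc k) - p))\<^sup>2)) \<longlonglongrightarrow> sqrt 0" by (intro tendsto_real_sqrt)
  then have "(\<lambda>k. Z (Suc k)) \<longlonglongrightarrow> p" by (simp add: tendsto_norm_zero_iff LIM_zero_iff)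
  then show ?thesis by (rule LIMSEQ_imp_Suc)
qed

theorem converges_to_minimizer:
  assumes div: "\<not> summable (\<lambda>k. 1 / \<rho> k)"
  obtains p where "Z \<longlonglongrightarrow> p" "L \<longlonglongrightarrow> p" "\<And>z. f p + h p \<le> f z + h z"
proof -
  obtain x y where xy: "saddle_pair f h x y" using saddle_exists by blast
  obtain r :: "nat \<Rightarrow> nat" where r: "strict_mono r" "(\<lambda>n. saddle_gap x y (Suc (r n))) \<longlonglongrightarrow> 0"
    by (rule saddle_gap_vanishes_along_subseq[OF xy div])
  \<comment> \<open>all three sequences are extracted jointly, so that they converge along a common subsequence\<close>
  define s where "s n = (let k = Suc (r n) in (Z (Suc k), Y (Suc k), predicted_dual k))" for n
  have "bounded (range (\<lambda>n. Z (Suc (Suc (r n)))))"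
  proof -
    have "dist x (Z (Suc k)) \<le> sqrt (energy x y (Suc 0))" for k
    proof (rule real_le_rsqrt)
      have "(norm (Z (Suc k) - x))\<^sup>2 \<le> energy x y (Suc k)" by (simp add: energy_def)
      also have "\<dots> \<le> energy x y (Suc 0)" using decseqD[OF decseq_energy[OF xy], of 0 k] by simp
      finally show "(dist x (Z (Suc k)))\<^sup>2 \<le> energy x y (Suc 0)" by (simp add: dist_norm norm_minus_commute)
    qed
    then show ?thesis unfolding bounded_def by blast
  qed
  moreover have "bounded (range (\<lambda>n. Y (Suc (Suc (r n)))))" "bounded (range (\<lambda>n. predicted_dual (Suc (r n))))"
    unfolding bounded_iff using dual_bounded predicted_dual_bounded by blast+
  ultimately have "bounded (range (\<lambda>n. Z (Suc (Suc (r n)))) \<times> (range (\<lambda>n. Y (Suc (Suc (r n)))) \<times>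
      range (\<lambda>n. predicted_dual (Suc (r n)))))"
    by (intro bounded_Times)
  then have "bounded (range s)"
    by (rule bounded_subset) (auto simp: s_def Let_def)
  then obtain l t where t: "strict_mono (t :: nat \<Rightarrow> nat)" "(s \<circ> t) \<longlonglongrightarrow> l"
    using bounded_imp_convergent_subsequence by blast
  obtain p q q' where l: "l = (p, q, q')" by (cases l)
  define k where "k n = Suc (r (t n))" for n
  have rt: "strict_mono (\<lambda>n. r (t n))" using r(1) t(1) by (simp add: strict_mono_def)
  then have k: "strict_mono k" by (simp add: strict_mono_def k_def)
  have lim: "(\<lambda>n. Z (Suc (k n))) \<longlonglongrightarrow> p" "(\<lambda>n. Y (Suc (k n))) \<longlonglongrightarrow> q" "(\<lambda>n. predicted_dual (k n)) \<longlonglongrightarrow> q'"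
    using tendsto_fst[OF t(2)] tendsto_fst[OF tendsto_snd[OF t(2)]] tendsto_snd[OF tendsto_snd[OF t(2)]]
    by (simp_all add: l s_def Let_def k_def o_def)
  have "strict_mono (\<lambda>n. Suc (k n))" using k by (simp add: strict_mono_def)
  then have "(\<lambda>n. L (Suc (k n)) - Z (Suc (k n))) \<longlonglongrightarrow> 0"
    using LIMSEQ_subseq_LIMSEQ[OF residual_tendsto_zero] by (force simp: o_def)
  from tendsto_add[OF this lim(1)] have Lp: "(\<lambda>n. L (Suc (k n))) \<longlonglongrightarrow> p" by simp
  have f: "subgradient f p (- q')"
    by (rule subgradient_limit[OF continuous_f L_subgradient Lp tendsto_minus[OF lim(3)]])
  have h: "subgradient h p q"
    by (rule subgradient_limit[OF continuous_h Z_step lim(1) lim(2)])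
  \<comment> \<open>a vanishing gap says that \<open>q - q'\<close> is orthogonal to \<open>p - x\<close>, so the two subgradient
    inequalities at \<open>p\<close>, tested at \<open>x\<close>, add up to optimality of \<open>p\<close>\<close>
  have "(\<lambda>n. saddle_gap x y (k n)) \<longlonglongrightarrow> (q - y) \<bullet> (p - x) + (y - q') \<bullet> (p - x)"
    unfolding saddle_gap_def by (intro tendsto_intros lim Lp)
  moreover have "(\<lambda>n. saddle_gap x y (k n)) \<longlonglongrightarrow> 0"
    using LIMSEQ_subseq_LIMSEQ[OF r(2) t(1)] by (simp add: o_def k_def)
  ultimately have "(q - y) \<bullet> (p - x) + (y - q') \<bullet> (p - x) = 0" using LIMSEQ_unique by blast
  then have "f p + h p \<le> f x + h x"
    using subgradientD[OF f, of x] subgradientD[OF h, of x] by (simp add: inner_simps)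
  then have py: "saddle_pair f h p y" by (rule saddle_pair_at_other_minimizer[OF xy])
  have Z: "Z \<longlonglongrightarrow> p" by (rule tendsto_of_subseq_tendsto[OF py k lim(1)])
  moreover have "L \<longlonglongrightarrow> p" using tendsto_add[OF residual_tendsto_zero Z] by simp
  ultimately show thesis using that saddle_pair_minimizes[OF py] by blast
qed

theorem dual_limit_is_subgradient:
  assumes div: "\<not> summable (\<lambda>k. 1 / (\<rho> k)\<^sup>2)" and L: "L \<longlonglongrightarrow> p" and Y: "Y \<longlonglongrightarrow> q"
  shows "subgradient f p (- q)"
proof -
  obtain r :: "nat \<Rightarrow> nat" where r: "strict_mono r"
    "(\<lambda>n. predicted_dual (Suc (r n)) - Y (Suc (Suc (r n)))) \<longlonglongrightarrow> 0"
    by (rule predicted_dual_gap_vanishes_along_subseq[OF div])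
  have k: "strict_mono (\<lambda>n. Suc (Suc (r n)))" using r(1) by (simp add: strict_mono_def)
  have "(\<lambda>n. Y (Suc (Suc (r n)))) \<longlonglongrightarrow> q" and Lp: "(\<lambda>n. L (Suc (Suc (r n)))) \<longlonglongrightarrow> p"
    using LIMSEQ_subseq_LIMSEQ[OF Y k] LIMSEQ_subseq_LIMSEQ[OF L k] by (simp_all add: o_def)
  from tendsto_add[OF r(2) this(1)] have "(\<lambda>n. predicted_dual (Suc (r n))) \<longlonglongrightarrow> q" by simp
  from subgradient_limit[OF continuous_f L_subgradient Lp tendsto_minus[OF this]] show ?thesis .
qed

end

section \<open>The sparse cost\<close>

lemma bounded_unique_subseq_limit:
  fixes x :: "nat \<Rightarrow> 'a::heine_borel"
  assumes bdd: "bounded (range x)"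
    and uniq: "\<And>r y. strict_mono (r :: nat \<Rightarrow> nat) \<Longrightarrow> (\<lambda>n. x (r n)) \<longlonglongrightarrow> y \<Longrightarrow> y = l"
  shows "x \<longlonglongrightarrow> l"
proof (rule ccontr)
  assume "\<not> x \<longlonglongrightarrow> l"
  then obtain e where e: "e > 0" "\<not> (\<forall>\<^sub>F n in sequentially. dist (x n) l < e)"
    by (auto simp: tendsto_iff)
  then have "infinite {n. \<not> dist (x n) l < e}"
    by (simp add: cofinite_eq_sequentially[symmetric] eventually_cofinite)
  then obtain r :: "nat \<Rightarrow> nat" where r: "strict_mono r" "\<And>n. \<not> dist (x (r n)) l < e"
    using infinite_enumerate by force
  have "bounded (range (\<lambda>n. x (r n)))" by (rule bounded_subset[OF bdd]) auto
  then obtain y s where s: "strict_mono (s :: nat \<Rightarrow> nat)" "(\<lambda>n. x (r (s n))) \<longlonglongrightarrow> y"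
    using bounded_imp_convergent_subsequence[of "\<lambda>n. x (r n)"] by (auto simp: o_def)
  have "y = l"
    by (rule uniq[of "\<lambda>n. r (s n)"]) (use r(1) s in \<open>auto simp: strict_mono_def\<close>)
  then have "\<forall>\<^sub>F n in sequentially. dist (x (r (s n))) l < e"
    using s(2) e(1) by (auto simp: tendsto_iff)
  then show False using r(2) by (auto simp: eventually_sequentially)
qed

lemma l1_norm_nonneg: "0 \<le> l1_norm A"
  by (simp add: l1_norm_def sum_nonneg)

lemma l1_norm_triangle: "l1_norm (A + B) \<le> l1_norm A + l1_norm B"
  by (simp add: l1_norm_def sum.distrib[symmetric] sum_mono abs_triangle_ineq)

lemma l1_norm_scaleR: "l1_norm (c *\<^sub>R A) = \<bar>c\<bar> * l1_norm A"
  by (simp add: l1_norm_def abs_mult sum_distrib_left)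

lemma l1_norm_zero [simp]: "l1_norm 0 = 0"
  by (simp add: l1_norm_def)

lemma norm_le_l1_norm: "norm A \<le> l1_norm A"
proof -
  have "norm A \<le> (\<Sum>i\<in>UNIV. norm (A $ i))"
    unfolding norm_vec_def[of A] by (rule L2_set_le_sum) simp
  also have "\<dots> \<le> l1_norm A"
    unfolding l1_norm_def by (intro sum_mono norm_le_l1_cart)
  finally show ?thesis .
qed

lemma l1_norm_le_norm: "l1_norm A \<le> CARD('m) * CARD('n) * norm A" for A :: "real ^ 'n ^ 'm"
proof -
  have "\<bar>A $ i $ j\<bar> \<le> norm A" for i j
    using component_le_norm_cart[of "A $ i" j] Finite_Cartesian_Product.norm_nth_le[of A i] by linarith
  then have "l1_norm A \<le> (\<Sum>i\<in>(UNIV::'m set). \<Sum>j\<in>(UNIV::'n set). norm A)"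
    unfolding l1_norm_def by (intro sum_mono)
  then show ?thesis by (simp add: mult.assoc)
qed

lemma l1_norm_eq_zero_iff: "l1_norm A = 0 \<longleftrightarrow> A = 0"
  using norm_le_l1_norm[of A] by auto

lemma tendsto_l1_norm: "(X \<longlongrightarrow> A) F \<Longrightarrow> ((\<lambda>k. l1_norm (X k)) \<longlongrightarrow> l1_norm A) F"
  unfolding l1_norm_def by (intro tendsto_intros)

lemma proj_on_nth: "proj_on \<Omega> A $ i $ j = (if (i, j) \<in> \<Omega> then A $ i $ j else 0)"
  by (simp add: proj_on_def)

lemma linear_proj_on: "linear (proj_on \<Omega>)"
  by (rule linearI) (simp_all add: vec_eq_iff proj_on_nth)

lemmas proj_on_add = linear_add[OF linear_proj_on]
  and proj_on_diff = linear_diff[OF linear_proj_on]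
  and proj_on_scaleR = linear_scale[OF linear_proj_on]
  and proj_on_zero = linear_0[OF linear_proj_on]

lemma proj_on_idem: "proj_on \<Omega> (proj_on \<Omega> A) = proj_on \<Omega> A"
  by (simp add: vec_eq_iff proj_on_nth)

lemma inner_proj_on: "proj_on \<Omega> A \<bullet> proj_on \<Omega> B = proj_on \<Omega> A \<bullet> B"
  unfolding inner_vec_def by (intro sum.cong refl) (simp add: proj_on_nth)

lemma tendsto_proj_on: "(X \<longlongrightarrow> A) F \<Longrightarrow> ((\<lambda>k. proj_on \<Omega> (X k)) \<longlongrightarrow> proj_on \<Omega> A) F"
  using bounded_linear.tendsto[OF linear_conv_bounded_linear[THEN iffD1, OF linear_proj_on]] .

lemma l1_norm_proj_on_split: "l1_norm A = l1_norm (proj_on \<Omega> A) + l1_norm (A - proj_on \<Omega> A)"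
  unfolding l1_norm_def sum.distrib[symmetric] by (intro sum.cong refl) (simp add: proj_on_nth)

lemma spcp_feasible_iff: "spcp_feasible \<Omega> D \<delta> (Z, S) \<longleftrightarrow> norm (proj_on \<Omega> (Z + S - D)) \<le> \<delta>"
  by (simp add: spcp_feasible_def)

lemma spcp_feasible_convex_comb:
  assumes "spcp_feasible \<Omega> D \<delta> (Z, S)" "spcp_feasible \<Omega> D \<delta> (Z', S')" "0 \<le> u" "0 \<le> v" "u + v = 1"
  shows "spcp_feasible \<Omega> D \<delta> (u *\<^sub>R Z + v *\<^sub>R Z', u *\<^sub>R S + v *\<^sub>R S')"
proof -
  have "u *\<^sub>R Z + v *\<^sub>R Z' + (u *\<^sub>R S + v *\<^sub>R S') - (u + v) *\<^sub>R D =
      u *\<^sub>R (Z + S - D) + v *\<^sub>R (Z' + S' - D)"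
    by (simp add: scaleR_diff_right scaleR_add_right scaleR_add_left)
  then have "proj_on \<Omega> (u *\<^sub>R Z + v *\<^sub>R Z' + (u *\<^sub>R S + v *\<^sub>R S') - D) =
      u *\<^sub>R proj_on \<Omega> (Z + S - D) + v *\<^sub>R proj_on \<Omega> (Z' + S' - D)"
    using assms(5) by (simp add: proj_on_add proj_on_scaleR)
  moreover have "norm \<dots> \<le> u * \<delta> + v * \<delta>"
    using assms by (intro order_trans[OF norm_triangle_ineq] add_mono) (auto simp: spcp_feasible_iff intro: mult_left_mono)
  moreover have "u * \<delta> + v * \<delta> = \<delta>" using assms(5) by (simp add: distrib_right[symmetric])
  ultimately show ?thesis by (simp add: spcp_feasible_iff)
qed

lemma convex_spcp_feasible: "convex {p. spcp_feasible \<Omega> D \<delta> p}"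
  by (rule convexI) (auto intro: spcp_feasible_convex_comb)

lemma convex_on_l1_norm_snd:
  assumes "0 \<le> \<xi>" "convex C"
  shows "convex_on C (\<lambda>p. \<xi> * l1_norm (snd p))"
proof (rule convex_onI)
  fix t :: real and p q :: "'a::real_vector \<times> (real ^ 'b ^ 'c)"
  assume t: "0 < t" "t < 1"
  have "l1_norm (snd ((1 - t) *\<^sub>R p + t *\<^sub>R q)) \<le> (1 - t) * l1_norm (snd p) + t * l1_norm (snd q)"
    using l1_norm_triangle[of "(1 - t) *\<^sub>R snd p" "t *\<^sub>R snd q"] t by (simp add: l1_norm_scaleR)
  from mult_left_mono[OF this assms(1)]
  show "\<xi> * l1_norm (snd ((1 - t) *\<^sub>R p + t *\<^sub>R q)) \<le>
      (1 - t) * (\<xi> * l1_norm (snd p)) + t * (\<xi> * l1_norm (snd q))"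
    by (simp add: algebra_simps)
qed fact

text \<open>
  The value function that eliminates \<open>S\<close> from the problem.
\<close>

definition sparse_cost ::
  "real \<Rightarrow> ('m \<times> 'n) set \<Rightarrow> real ^ 'n ^ 'm \<Rightarrow> real \<Rightarrow> real ^ 'n ^ 'm \<Rightarrow> real" where
  "sparse_cost \<xi> \<Omega> D \<delta> Z = (INF S\<in>{S. spcp_feasible \<Omega> D \<delta> (Z, S)}. \<xi> * l1_norm S)"

context
  fixes \<xi> \<delta> :: real and \<Omega> :: "('m::finite \<times> 'n::finite) set" and D :: "real ^ 'n ^ 'm"
  assumes \<xi>: "0 < \<xi>" and \<delta>: "0 \<le> \<delta>"
begin

lemma feasible_residual: "spcp_feasible \<Omega> D \<delta> (Z, D - Z)"
  using \<delta> by (simp add: spcp_feasible_iff proj_on_zero)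

lemma sparse_cost_le:
  assumes "spcp_feasible \<Omega> D \<delta> (Z, S)"
  shows "sparse_cost \<xi> \<Omega> D \<delta> Z \<le> \<xi> * l1_norm S"
  unfolding sparse_cost_def
proof (rule cINF_lower)
  show "bdd_below ((\<lambda>S. \<xi> * l1_norm S) ` {S. spcp_feasible \<Omega> D \<delta> (Z, S)})"
    using \<xi> by (intro bdd_belowI2[where m = 0]) (simp add: l1_norm_nonneg)
qed (use assms in simp)

lemma sparse_cost_greatest:
  assumes "\<And>S. spcp_feasible \<Omega> D \<delta> (Z, S) \<Longrightarrow> c \<le> \<xi> * l1_norm S"
  shows "c \<le> sparse_cost \<xi> \<Omega> D \<delta> Z"
  unfolding sparse_cost_def using feasible_residual[of Z] assms by (intro cINF_greatest) auto

lemma sparse_cost_nonneg: "0 \<le> sparse_cost \<xi> \<Omega> D \<delta> Z"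
  using \<xi> by (intro sparse_cost_greatest) (simp add: l1_norm_nonneg)

lemma sparse_cost_approx:
  assumes "0 < e"
  obtains S where "spcp_feasible \<Omega> D \<delta> (Z, S)" "\<xi> * l1_norm S < sparse_cost \<xi> \<Omega> D \<delta> Z + e"
  using sparse_cost_greatest[of Z "sparse_cost \<xi> \<Omega> D \<delta> Z + e"] assms that by force

lemma convex_on_sparse_cost: "convex_on UNIV (sparse_cost \<xi> \<Omega> D \<delta>)"
proof (rule convex_onI)
  fix t :: real and Z Z' :: "real ^ 'n ^ 'm"
  assume t: "0 < t" "t < 1"
  let ?h = "sparse_cost \<xi> \<Omega> D \<delta>"
  show "?h ((1 - t) *\<^sub>R Z + t *\<^sub>R Z') \<le> (1 - t) * ?h Z + t * ?h Z'"
  proof (rule field_le_epsilon)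
    fix e :: real assume e: "0 < e"
    obtain S S' where S: "spcp_feasible \<Omega> D \<delta> (Z, S)" "\<xi> * l1_norm S < ?h Z + e"
      and S': "spcp_feasible \<Omega> D \<delta> (Z', S')" "\<xi> * l1_norm S' < ?h Z' + e"
      using sparse_cost_approx[OF e, of Z] sparse_cost_approx[OF e, of Z'] by metis
    have "?h ((1 - t) *\<^sub>R Z + t *\<^sub>R Z') \<le> \<xi> * l1_norm ((1 - t) *\<^sub>R S + t *\<^sub>R S')"
      using t S S' by (intro sparse_cost_le spcp_feasible_convex_comb) auto
    also have "\<dots> \<le> (1 - t) * (\<xi> * l1_norm S) + t * (\<xi> * l1_norm S')"
      using convex_onD[OF convex_on_l1_norm_snd[of \<xi> UNIV], of t "(Z, S)" "(Z', S')"] \<xi> t by simp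
    also have "\<dots> \<le> (1 - t) * (?h Z + e) + t * (?h Z' + e)"
      using t S S' by (intro add_mono mult_left_mono) auto
    finally show "?h ((1 - t) *\<^sub>R Z + t *\<^sub>R Z') \<le> (1 - t) * ?h Z + t * ?h Z' + e"
      by (simp add: algebra_simps)
  qed
qed auto

text \<open>
  If \<open>S\<close> is feasible for \<open>Z'\<close>, then \<open>S + (Z' - Z)\<close> is feasible for \<open>Z\<close>, with the same residual.
\<close>

lemma sparse_cost_diff_le:
  "sparse_cost \<xi> \<Omega> D \<delta> Z - sparse_cost \<xi> \<Omega> D \<delta> Z' \<le> \<xi> * (CARD('m) * CARD('n)) * norm (Z - Z')"
proof -
  have "sparse_cost \<xi> \<Omega> D \<delta> Z - \<xi> * l1_norm (Z' - Z) \<le> \<xi> * l1_norm S"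
    if "spcp_feasible \<Omega> D \<delta> (Z', S)" for S
  proof -
    have "sparse_cost \<xi> \<Omega> D \<delta> Z \<le> \<xi> * l1_norm (S + (Z' - Z))"
      using that by (intro sparse_cost_le) (simp add: spcp_feasible_iff algebra_simps)
    also have "\<dots> \<le> \<xi> * (l1_norm S + l1_norm (Z' - Z))"
      using \<xi> l1_norm_triangle by (intro mult_left_mono) auto
    finally show ?thesis by (simp add: algebra_simps)
  qed
  then have "sparse_cost \<xi> \<Omega> D \<delta> Z - \<xi> * l1_norm (Z' - Z) \<le> sparse_cost \<xi> \<Omega> D \<delta> Z'"
    by (rule sparse_cost_greatest)
  moreover have "\<xi> * l1_norm (Z' - Z) \<le> \<xi> * (CARD('m) * CARD('n) * norm (Z' - Z))"
    using \<xi> l1_norm_le_norm[of "Z' - Z"] by (intro mult_left_mono) auto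
  ultimately show ?thesis by (simp add: norm_minus_commute algebra_simps)
qed

text \<open>
  Minimisers are supported on \<open>\<Omega>\<close>, because dropping the entries outside \<open>\<Omega>\<close> keeps feasibility and
  lowers the norm. If two minimisers differed, their residuals would differ, and by the parallelogram
  law their midpoint \<open>M\<close> would satisfy the constraint strictly. Then \<open>(1 - t) *\<^sub>R M\<close> is still feasible
  for small \<open>t > 0\<close> and has smaller norm, unless the minimum is \<open>0\<close>, where both minimisers vanish.
\<close>

lemma sparse_cost_minimizer_unique:
  assumes S: "spcp_feasible \<Omega> D \<delta> (Z, S)" "\<xi> * l1_norm S = sparse_cost \<xi> \<Omega> D \<delta> Z"
    and S': "spcp_feasible \<Omega> D \<delta> (Z, S')" "\<xi> * l1_norm S' = sparse_cost \<xi> \<Omega> D \<delta> Z"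
  shows "S = S'"
proof (rule ccontr)
  assume "S \<noteq> S'"
  have min: "l1_norm S \<le> l1_norm T" if "spcp_feasible \<Omega> D \<delta> (Z, T)" for T
    using sparse_cost_le[OF that] unfolding S(2)[symmetric] using \<xi> by simp
  have "\<xi> * l1_norm S' = \<xi> * l1_norm S" by (simp only: S(2) S'(2))
  then have eq: "l1_norm S' = l1_norm S" using \<xi> by simp
  have supp: "proj_on \<Omega> T = T" if T: "spcp_feasible \<Omega> D \<delta> (Z, T)" "l1_norm T = l1_norm S" for T
  proof -
    have "spcp_feasible \<Omega> D \<delta> (Z, proj_on \<Omega> T)"
      using T(1) by (simp add: spcp_feasible_iff proj_on_add proj_on_diff proj_on_idem)
    from min[OF this] have "l1_norm (T - proj_on \<Omega> T) = 0"
      using l1_norm_proj_on_split[of T \<Omega>] l1_norm_nonneg[of "T - proj_on \<Omega> T"] T(2) by linarith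
    then show ?thesis by (simp add: l1_norm_eq_zero_iff)
  qed
  define M where "M = (1/2) *\<^sub>R S + (1/2) *\<^sub>R S'"
  define a where "a = proj_on \<Omega> (Z + S - D)"
  define b where "b = proj_on \<Omega> (Z + S' - D)"
  have "a - b = S - S'"
    using supp[OF S(1) refl] supp[OF S'(1) eq] by (simp add: a_def b_def proj_on_diff[symmetric]) (simp add: proj_on_diff)
  then have ab: "a \<noteq> b" using \<open>S \<noteq> S'\<close> by auto
  have mid: "proj_on \<Omega> (Z + M - D) = (1/2) *\<^sub>R a + (1/2) *\<^sub>R b"
  proof -
    have "Z + M - D = (1/2) *\<^sub>R (Z + S - D) + (1/2) *\<^sub>R (Z + S' - D)"
      by (simp add: M_def vec_eq_iff field_simps)
    then show ?thesis by (simp add: a_def b_def proj_on_add proj_on_scaleR)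
  qed
  have "(norm (proj_on \<Omega> (Z + M - D)))\<^sup>2 = ((norm a)\<^sup>2 + (norm b)\<^sup>2) / 2 - (norm (a - b))\<^sup>2 / 4"
    unfolding power2_norm_eq_inner mid by (simp add: inner_simps inner_commute field_simps)
  moreover have "(norm a)\<^sup>2 \<le> \<delta>\<^sup>2" "(norm b)\<^sup>2 \<le> \<delta>\<^sup>2"
    using S(1) S'(1) by (simp_all add: a_def b_def spcp_feasible_iff power_mono)
  moreover have "(norm (a - b))\<^sup>2 > 0" using ab by simp
  moreover have "v < d" if "v = (p + q) / 2 - c / 4" "p \<le> d" "q \<le> d" "0 < c" for v p q c d :: real
    using that by argo
  ultimately have "(norm (proj_on \<Omega> (Z + M - D)))\<^sup>2 < \<delta>\<^sup>2" by blast
  then have strict: "norm (proj_on \<Omega> (Z + M - D)) < \<delta>" using \<delta> by (rule power_less_imp_less_base)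
  have M_le: "l1_norm M \<le> l1_norm S"
    using l1_norm_triangle[of "(1/2) *\<^sub>R S" "(1/2) *\<^sub>R S'"] by (simp add: M_def l1_norm_scaleR eq)
  have "((\<lambda>t. norm (proj_on \<Omega> (Z + (1 - t) *\<^sub>R M - D))) \<longlongrightarrow> norm (proj_on \<Omega> (Z + (1 - 0) *\<^sub>R M - D))) (at_right 0)"
    by (intro tendsto_intros tendsto_proj_on)
  then have "\<forall>\<^sub>F t in at_right 0. norm (proj_on \<Omega> (Z + (1 - t) *\<^sub>R M - D)) < \<delta>"
    using strict by (intro order_tendstoD) auto
  moreover have "\<forall>\<^sub>F t in at_right (0::real). 0 < t \<and> t < 1"
    unfolding eventually_at_right_field by (intro exI[of _ 1]) auto
  ultimately have "\<forall>\<^sub>F t in at_right 0. norm (proj_on \<Omega> (Z + (1 - t) *\<^sub>R M - D)) < \<delta> \<and> (0 < t \<and> t < 1)"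
    by (rule eventually_conj)
  then obtain t where "norm (proj_on \<Omega> (Z + (1 - t) *\<^sub>R M - D)) < \<delta>" "0 < t" "t < 1"
    using eventually_happens'[OF trivial_limit_at_right_real] by blast
  then have t: "0 < t" "t < 1" "spcp_feasible \<Omega> D \<delta> (Z, (1 - t) *\<^sub>R M)"
    by (simp_all add: spcp_feasible_iff)
  have "l1_norm S \<le> (1 - t) * l1_norm M" using min[OF t(3)] t by (simp add: l1_norm_scaleR)
  also have "\<dots> \<le> (1 - t) * l1_norm S" using M_le t by simp
  finally have "t * l1_norm S \<le> 0" by (simp add: algebra_simps)
  then have "l1_norm S = 0" using t l1_norm_nonneg[of S] by (simp add: mult_le_0_iff)
  then have "S = 0" "S' = 0" using eq by (simp_all add: l1_norm_eq_zero_iff)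
  with \<open>S \<noteq> S'\<close> show False by simp
qed

lemma continuous_on_sparse_cost: "continuous_on UNIV (sparse_cost \<xi> \<Omega> D \<delta>)"
  by (rule convex_on_continuous[OF open_UNIV convex_on_sparse_cost])

text \<open>
  Continuity of the value function makes every limit point of \<open>S\<close> a minimiser for \<open>Ls\<close>, and there
  is only one.
\<close>

lemma sparse_minimizers_converge:
  assumes Z: "Z \<longlonglongrightarrow> Ls" and S: "\<And>k. spcp_feasible \<Omega> D \<delta> (Z k, S k)"
    "\<And>k. \<xi> * l1_norm (S k) = sparse_cost \<xi> \<Omega> D \<delta> (Z k)"
  obtains Ss where "S \<longlonglongrightarrow> Ss" "spcp_feasible \<Omega> D \<delta> (Ls, Ss)" "\<xi> * l1_norm Ss = sparse_cost \<xi> \<Omega> D \<delta> Ls"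
proof -
  let ?h = "sparse_cost \<xi> \<Omega> D \<delta>"
  have hZ: "(\<lambda>k. ?h (Z k)) \<longlonglongrightarrow> ?h Ls"
    by (rule continuous_on_tendsto_compose[OF continuous_on_sparse_cost Z]) auto
  have limit: "spcp_feasible \<Omega> D \<delta> (Ls, T)" "\<xi> * l1_norm T = ?h Ls"
    if r: "strict_mono (r :: nat \<Rightarrow> nat)" and T: "(\<lambda>n. S (r n)) \<longlonglongrightarrow> T" for r T
  proof -
    have Zr: "(\<lambda>n. Z (r n)) \<longlonglongrightarrow> Ls" using LIMSEQ_subseq_LIMSEQ[OF Z r] by (simp add: o_def)
    have "(\<lambda>n. norm (proj_on \<Omega> (Z (r n) + S (r n) - D))) \<longlonglongrightarrow> norm (proj_on \<Omega> (Ls + T - D))"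
      by (intro tendsto_intros tendsto_proj_on Zr T)
    then show "spcp_feasible \<Omega> D \<delta> (Ls, T)"
      using S(1) unfolding spcp_feasible_iff by (intro LIMSEQ_le_const2) auto
    have "(\<lambda>n. \<xi> * l1_norm (S (r n))) \<longlonglongrightarrow> \<xi> * l1_norm T"
      by (intro tendsto_intros tendsto_l1_norm T)
    moreover have "(\<lambda>n. \<xi> * l1_norm (S (r n))) \<longlonglongrightarrow> ?h Ls"
      using LIMSEQ_subseq_LIMSEQ[OF hZ r] by (simp add: o_def S(2))
    ultimately show "\<xi> * l1_norm T = ?h Ls" by (rule LIMSEQ_unique)
  qed
  have bdd: "bounded (range S)"
  proof -
    obtain B where B: "\<And>k. norm (?h (Z k)) \<le> B"
      using convergent_imp_bounded[OF hZ] unfolding bounded_iff by auto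
    have "norm (S k) \<le> B / \<xi>" for k
    proof -
      have "\<xi> * norm (S k) \<le> \<xi> * l1_norm (S k)" using \<xi> norm_le_l1_norm by simp
      also have "\<dots> \<le> B" using B[of k] by (simp add: S(2))
      finally show ?thesis using \<xi> by (simp add: field_simps)
    qed
    then show ?thesis unfolding bounded_iff by blast
  qed
  obtain Ss r where r: "strict_mono (r :: nat \<Rightarrow> nat)" "(\<lambda>n. S (r n)) \<longlonglongrightarrow> Ss"
    using bounded_imp_convergent_subsequence[OF bdd] by (auto simp: o_def)
  note Ss = limit[OF r]
  have "S \<longlonglongrightarrow> Ss"
  proof (rule bounded_unique_subseq_limit[OF bdd])
    fix r' T assume "strict_mono (r' :: nat \<Rightarrow> nat)" "(\<lambda>n. S (r' n)) \<longlonglongrightarrow> T"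
    from limit[OF this] show "T = Ss" by (rule sparse_cost_minimizer_unique[OF _ _ Ss])
  qed
  with Ss that show thesis by blast
qed

text \<open>
  The sum of the two functions is bounded below by the Frobenius norm, hence coercive, and so it
  attains its minimum on the ball whose radius is its value at \<open>0\<close>.
\<close>

lemma nuclear_sparse_saddle_exists:
  "\<exists>x y. saddle_pair nuclear_norm (sparse_cost \<xi> \<Omega> D \<delta>) x y"
proof -
  define F where "F x = nuclear_norm x + sparse_cost \<xi> \<Omega> D \<delta> x" for x
  have F: "norm x \<le> F x" for x
    using norm_le_nuclear_norm[of x] sparse_cost_nonneg[of x] by (simp add: F_def)
  have "continuous_on UNIV F"
    unfolding F_def
    by (intro continuous_on_add convex_on_continuous[OF open_UNIV] convex_on_nuclear_norm convex_on_sparse_cost)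
  then have "continuous_on (cball 0 (F 0)) F" by (rule continuous_on_subset) simp
  moreover have "cball 0 (F 0) \<noteq> {}" using F[of 0] by simp
  ultimately have "\<exists>x\<in>cball 0 (F 0). \<forall>z\<in>cball 0 (F 0). F x \<le> F z"
    by (intro continuous_attains_inf compact_cball)
  then obtain x where "\<forall>z\<in>cball 0 (F 0). F x \<le> F z" by blast
  then have x: "F x \<le> F z" if "norm z \<le> F 0" for z using that by simp
  have "F x \<le> F z" for z
  proof (cases "norm z \<le> F 0")
    case False
    moreover have "F x \<le> F 0" using x[of 0] F[of 0] by simp
    ultimately show ?thesis using F[of z] by linarith
  qed (rule x)
  then have "nuclear_norm x + sparse_cost \<xi> \<Omega> D \<delta> x \<le> nuclear_norm z + sparse_cost \<xi> \<Omega> D \<delta> z" for z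
    by (simp add: F_def)
  then obtain y where "subgradient nuclear_norm x (- y)" "subgradient (sparse_cost \<xi> \<Omega> D \<delta>) x y"
    by (rule subgradient_of_sum_minimizer[OF convex_on_nuclear_norm convex_on_sparse_cost])
  then show ?thesis unfolding saddle_pair_def by blast
qed

end

section \<open>Optimality conditions of the subproblems\<close>

lemma linear_proj_on_plus: "linear (\<lambda>p. proj_on \<Omega> (fst p + snd p))"
  by (rule linearI) (simp_all add: proj_on_add proj_on_scaleR scaleR_add_right)

lemma proj_on_residual: "proj_on \<Omega> (Z + S - D) = proj_on \<Omega> (fst (Z, S) + snd (Z, S)) - proj_on \<Omega> D"
  by (simp add: proj_on_diff)

lemma L_step_subgradient:
  assumes "is_arg_min (L_objective \<rho> Y Z) (\<lambda>_. True) L"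
  shows "subgradient nuclear_norm L (- (Y + \<rho> *\<^sub>R (L - Z)))"
  unfolding subgradient_def
proof
  fix X
  have "nuclear_norm L + (Y + \<rho> *\<^sub>R (L - Z)) \<bullet> L \<le> nuclear_norm X + (Y + \<rho> *\<^sub>R (L - Z)) \<bullet> X"
    using assms
    by (intro linearize_quadratic_at_minimizer[OF convex_on_nuclear_norm, where P = "\<lambda>x. x"])
      (auto simp: is_arg_min_linorder L_objective_def linear_id[unfolded id_def])
  then show "nuclear_norm L + - (Y + \<rho> *\<^sub>R (L - Z)) \<bullet> (X - L) \<le> nuclear_norm X"
    by (simp only: inner_diff_right inner_minus_left)
qed

lemma ZS_step_subgradient:
  fixes Z S :: "real ^ 'n ^ 'm"
  assumes \<xi>: "0 \<le> \<xi>" and argmin: "is_arg_min (ZS_objective \<xi> \<rho> Y L) (spcp_feasible \<Omega> D \<delta>) (Z, S)"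
    and feas: "spcp_feasible \<Omega> D \<delta> (Z', S')"
  shows "\<xi> * l1_norm S + (Y + \<rho> *\<^sub>R (L - Z)) \<bullet> (Z' - Z) \<le> \<xi> * l1_norm S'"
proof -
  have "\<xi> * l1_norm (snd (Z, S)) + (- Y + \<rho> *\<^sub>R (fst (Z, S) - L)) \<bullet> fst (Z, S) \<le>
      \<xi> * l1_norm (snd (Z', S')) + (- Y + \<rho> *\<^sub>R (fst (Z, S) - L)) \<bullet> fst (Z', S')"
  proof (rule linearize_quadratic_at_minimizer[OF convex_on_l1_norm_snd[OF \<xi> convex_spcp_feasible] linear_fst])
    fix p assume "p \<in> {p. spcp_feasible \<Omega> D \<delta> p}"
    then show "\<xi> * l1_norm (snd (Z, S)) + - Y \<bullet> (fst (Z, S) - L) + \<rho> / 2 * (norm (fst (Z, S) - L))\<^sup>2 \<le>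
        \<xi> * l1_norm (snd p) + - Y \<bullet> (fst p - L) + \<rho> / 2 * (norm (fst p - L))\<^sup>2"
      using argmin by (auto simp: is_arg_min_linorder ZS_objective_def case_prod_beta)
  qed (use feas argmin in \<open>auto simp: is_arg_min_linorder\<close>)
  moreover have "- Y + \<rho> *\<^sub>R (Z - L) = - (Y + \<rho> *\<^sub>R (L - Z))" by (simp add: algebra_simps)
  ultimately show ?thesis
    by (simp only: fst_conv snd_conv inner_diff_right inner_minus_left)
qed

lemma ZS_objective_eq: "ZS_objective \<xi> \<rho> Y L p =
    \<xi> * l1_norm (snd p) + ((- Y) \<bullet> (fst p - L) + \<rho> / 2 * (norm (fst p - L))\<^sup>2)"
  by (simp add: ZS_objective_def case_prod_beta)

lemma convex_on_ZS_objective: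
  assumes "0 \<le> \<xi>" "0 \<le> \<rho>"
  shows "convex_on UNIV (ZS_objective \<xi> \<rho> Y L)"
proof -
  have "convex_on UNIV (\<lambda>p. \<xi> * l1_norm (snd p) + ((- Y) \<bullet> (fst p - L) + \<rho> / 2 * (norm (fst p - L))\<^sup>2))"
    using assms
  proof (intro convex_on_add convex_on_l1_norm_snd convex_on_cmul convex_on_norm_affine_squared linear_fst)
    show "convex_on UNIV (\<lambda>p. (- Y) \<bullet> (fst p - L))"
      by (rule convex_onI) (auto simp: inner_simps algebra_simps)
  qed auto
  then show ?thesis unfolding ZS_objective_eq[abs_def] .
qed

lemma convex_on_proj_residual: "convex_on UNIV (\<lambda>p. (norm (proj_on \<Omega> (fst p + snd p - D)))\<^sup>2)"
  using convex_on_norm_affine_squared[OF linear_proj_on_plus, of \<Omega> "proj_on \<Omega> D"]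
  by (simp add: proj_on_diff)

text \<open>
  A multiplier \<open>\<theta>'\<close> that closes the duality gap exists, with Slater point \<open>(0, D)\<close>. The dual value at
  the maximiser \<open>\<theta>\<close> is at least the one at \<open>\<theta>'\<close>, so \<open>\<theta>\<close> closes the gap as well; evaluating at
  \<open>(Z, S)\<close> gives complementary slackness.
\<close>

lemma optimal_multiplier_saddle:
  assumes \<xi>: "0 \<le> \<xi>" and \<delta>: "0 < \<delta>" and \<rho>: "0 \<le> \<rho>"
    and argmin: "is_arg_min (ZS_objective \<xi> \<rho> Y L) (spcp_feasible \<Omega> D \<delta>) (Z, S)"
    and mult: "optimal_multiplier \<xi> \<Omega> D \<delta> \<rho> Y L \<theta>"
  shows "0 \<le> \<theta>" "\<theta> * ((norm (proj_on \<Omega> (Z + S - D)))\<^sup>2 - \<delta>\<^sup>2) = 0"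
    "ZS_objective \<xi> \<rho> Y L (Z, S) \<le> ZS_objective \<xi> \<rho> Y L (Z', S')
       + \<theta> * (1 / 2 * (norm (proj_on \<Omega> (Z' + S' - D)))\<^sup>2 - \<delta>\<^sup>2 / 2)"
proof -
  let ?F = "ZS_objective \<xi> \<rho> Y L"
  define G where "G p = 1 / 2 * (norm (proj_on \<Omega> (fst p + snd p - D)))\<^sup>2 + - (\<delta>\<^sup>2 / 2)" for p
  have feas: "spcp_feasible \<Omega> D \<delta> p \<longleftrightarrow> G p \<le> 0" for p
    using \<delta> power2_le_iff_abs_le[of \<delta> "norm (proj_on \<Omega> (fst p + snd p - D))"]
    by (simp add: spcp_feasible_def case_prod_beta G_def)
  have "convex_on UNIV G"
    unfolding G_def by (intro convex_on_add convex_on_cmul convex_on_proj_residual) (auto simp: convex_on_const)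
  moreover have "G (0, D) < 0" using \<delta> by (simp add: G_def proj_on_zero)
  moreover have "?F (Z, S) \<le> ?F p" if "G p \<le> 0" for p
    using argmin that by (cases p) (auto simp: is_arg_min_linorder feas)
  ultimately obtain \<theta>' where \<theta>': "0 \<le> \<theta>'" "\<And>p. ?F (Z, S) \<le> ?F p + \<theta>' * G p"
    using lagrange_multiplier_exists[OF convex_on_ZS_objective[OF \<xi> \<rho>]] by metis
  show \<theta>: "0 \<le> \<theta>" using mult by (simp add: optimal_multiplier_def is_arg_max_def)
  have dual: "ZS_dual \<xi> \<Omega> D \<delta> \<rho> Y L t = (INF p. ereal (?F p + t * G p))" for t
    by (simp add: ZS_dual_def G_def case_prod_beta)
  have "ereal (?F (Z, S)) \<le> ZS_dual \<xi> \<Omega> D \<delta> \<rho> Y L \<theta>'"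
    unfolding dual using \<theta>'(2) by (intro INF_greatest) simp
  also have "\<dots> \<le> ZS_dual \<xi> \<Omega> D \<delta> \<rho> Y L \<theta>"
    using mult \<theta>'(1) by (auto simp: optimal_multiplier_def is_arg_max_linorder)
  finally have "ereal (?F (Z, S)) \<le> (INF p. ereal (?F p + \<theta> * G p))" unfolding dual .
  from order_trans[OF this INF_lower[OF UNIV_I]] have le: "?F (Z, S) \<le> ?F p + \<theta> * G p" for p
    by simp
  show "?F (Z, S) \<le> ?F (Z', S') + \<theta> * (1 / 2 * (norm (proj_on \<Omega> (Z' + S' - D)))\<^sup>2 - \<delta>\<^sup>2 / 2)"
    using le[of "(Z', S')"] by (simp add: G_def)
  have "G (Z, S) \<le> 0" using argmin by (simp add: is_arg_min_linorder feas)
  then have "\<theta> * G (Z, S) \<le> 0" using \<theta> by (simp add: mult_nonneg_nonpos)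
  moreover have "0 \<le> \<theta> * G (Z, S)" using le[of "(Z, S)"] by simp
  ultimately have "\<theta> * G (Z, S) = 0" by simp
  then show "\<theta> * ((norm (proj_on \<Omega> (Z + S - D)))\<^sup>2 - \<delta>\<^sup>2) = 0" by (simp add: G_def)
qed

text \<open>
  Replacing the proximal term by its linearisation turns the shifted multiplier \<open>Y\<close> into the updated
  multiplier \<open>U\<close>. What remains is the \<open>(Z, S)\<close> part of the Lagrangian of the full problem, whose
  minimality passes to the limit.
\<close>

lemma ZS_step_lagrangian:
  fixes Z S Z' S' :: "real ^ 'n ^ 'm"
  assumes \<xi>: "0 \<le> \<xi>" and \<delta>: "0 < \<delta>" and \<rho>: "0 \<le> \<rho>"
    and argmin: "is_arg_min (ZS_objective \<xi> \<rho> Y L) (spcp_feasible \<Omega> D \<delta>) (Z, S)"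
    and mult: "optimal_multiplier \<xi> \<Omega> D \<delta> \<rho> Y L \<theta>"
    and U: "U = Y + \<rho> *\<^sub>R (L - Z)"
  shows "\<xi> * l1_norm S + \<theta> / 2 * (norm (proj_on \<Omega> (Z + S - D)))\<^sup>2 - U \<bullet> Z
    \<le> \<xi> * l1_norm S' + \<theta> / 2 * (norm (proj_on \<Omega> (Z' + S' - D)))\<^sup>2 - U \<bullet> Z'"
proof -
  note sad = optimal_multiplier_saddle[OF \<xi> \<delta> \<rho> argmin mult]
  define F where "F p = \<xi> * l1_norm (snd p) + \<theta> / 2 * (norm (proj_on \<Omega> (fst p + snd p - D)))\<^sup>2" for p
  have F: "convex_on UNIV F"
    unfolding F_def using \<xi> sad(1)
    by (intro convex_on_add convex_on_cmul convex_on_l1_norm_snd convex_on_proj_residual) auto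
  have "F (Z, S) + (- Y + \<rho> *\<^sub>R (fst (Z, S) - L)) \<bullet> fst (Z, S) \<le>
      F (Z', S') + (- Y + \<rho> *\<^sub>R (fst (Z, S) - L)) \<bullet> fst (Z', S')"
  proof (rule linearize_quadratic_at_minimizer[OF F linear_fst])
    fix p :: "(real ^ 'n ^ 'm) \<times> (real ^ 'n ^ 'm)"
    have "F (Z, S) = \<xi> * l1_norm S + \<theta> * \<delta>\<^sup>2 / 2"
      using sad(2) by (simp add: F_def algebra_simps)
    moreover have "F p = \<xi> * l1_norm (snd p) + \<theta> * (1 / 2 * (norm (proj_on \<Omega> (fst p + snd p - D)))\<^sup>2 - \<delta>\<^sup>2 / 2)
        + \<theta> * \<delta>\<^sup>2 / 2"
      by (simp add: F_def algebra_simps)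
    ultimately show "F (Z, S) + - Y \<bullet> (fst (Z, S) - L) + \<rho> / 2 * (norm (fst (Z, S) - L))\<^sup>2 \<le>
        F p + - Y \<bullet> (fst p - L) + \<rho> / 2 * (norm (fst p - L))\<^sup>2"
      using sad(3)[of "fst p" "snd p"] unfolding ZS_objective_eq fst_conv snd_conv by linarith
  qed auto
  moreover have "- Y + \<rho> *\<^sub>R (Z - L) = - U" by (simp add: U algebra_simps)
  ultimately show ?thesis by (simp add: F_def)
qed

text \<open>
  After linearising the constraint term too, variation of \<open>Z\<close> alone leaves a linear function bounded
  below, which gives the formula for \<open>U\<close>. Scaling \<open>S\<close> by \<open>0\<close> and by \<open>2\<close> gives Euler's identity for
  the homogeneous function \<open>l1_norm\<close>, in place of a sign condition on each entry.
\<close>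

lemma ZS_step_stationarity:
  fixes Z S :: "real ^ 'n ^ 'm"
  assumes \<xi>: "0 \<le> \<xi>"
    and min: "\<And>Z' S'. \<xi> * l1_norm S + \<theta> / 2 * (norm (proj_on \<Omega> (Z + S - D)))\<^sup>2 - U \<bullet> Z
    \<le> \<xi> * l1_norm S' + \<theta> / 2 * (norm (proj_on \<Omega> (Z' + S' - D)))\<^sup>2 - U \<bullet> Z'"
  shows "U = \<theta> *\<^sub>R proj_on \<Omega> (Z + S - D)" "U \<bullet> S = - (\<xi> * l1_norm S)"
proof -
  define R where "R = proj_on \<Omega> (Z + S - D)"
  define F where "F p = \<xi> * l1_norm (snd p) + (- U) \<bullet> fst p"
    for p :: "(real ^ 'n ^ 'm) \<times> (real ^ 'n ^ 'm)"
  have F: "convex_on UNIV F"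
    unfolding F_def
  proof (intro convex_on_add convex_on_l1_norm_snd \<xi>)
    show "convex_on UNIV (\<lambda>p. (- U) \<bullet> fst p)"
      by (rule convex_onI) (auto simp: inner_simps algebra_simps)
  qed auto
  have RR: "R \<bullet> proj_on \<Omega> X = R \<bullet> X" for X by (simp add: R_def inner_proj_on)
  have le: "\<xi> * l1_norm S - U \<bullet> Z + \<theta> * (R \<bullet> (Z + S)) \<le> \<xi> * l1_norm S' - U \<bullet> Z' + \<theta> * (R \<bullet> (Z' + S'))" for Z' S'
  proof -
    have "F (Z, S) + (0 + \<theta> *\<^sub>R (proj_on \<Omega> (fst (Z, S) + snd (Z, S)) - proj_on \<Omega> D)) \<bullet>
        proj_on \<Omega> (fst (Z, S) + snd (Z, S)) \<le>
      F (Z', S') + (0 + \<theta> *\<^sub>R (proj_on \<Omega> (fst (Z, S) + snd (Z, S)) - proj_on \<Omega> D)) \<bullet>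
        proj_on \<Omega> (fst (Z', S') + snd (Z', S'))"
    proof (rule linearize_quadratic_at_minimizer[OF F linear_proj_on_plus])
      fix p :: "(real ^ 'n ^ 'm) \<times> (real ^ 'n ^ 'm)"
      show "F (Z, S) + 0 \<bullet> (proj_on \<Omega> (fst (Z, S) + snd (Z, S)) - proj_on \<Omega> D) +
          \<theta> / 2 * (norm (proj_on \<Omega> (fst (Z, S) + snd (Z, S)) - proj_on \<Omega> D))\<^sup>2 \<le>
        F p + 0 \<bullet> (proj_on \<Omega> (fst p + snd p) - proj_on \<Omega> D) +
          \<theta> / 2 * (norm (proj_on \<Omega> (fst p + snd p) - proj_on \<Omega> D))\<^sup>2"
        using min[of "snd p" "fst p"] by (simp add: F_def proj_on_diff)
    qed auto
    then show ?thesis unfolding proj_on_residual[symmetric] R_def[symmetric] by (simp add: F_def RR)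
  qed
  have "(\<theta> *\<^sub>R R - U) \<bullet> (\<theta> *\<^sub>R R - U) \<le> 0"
    using le[of S "Z - (\<theta> *\<^sub>R R - U)"] by (simp add: inner_simps algebra_simps)
  then have "\<theta> *\<^sub>R R - U = 0" by (metis inner_eq_zero_iff inner_ge_zero order_antisym)
  then show U: "U = \<theta> *\<^sub>R proj_on \<Omega> (Z + S - D)" by (simp add: R_def)
  have UX: "\<theta> * (R \<bullet> X) = U \<bullet> X" for X using U by (simp add: R_def)
  have UX2: "\<theta> * (2 * (R \<bullet> X)) = 2 * (U \<bullet> X)" for X using UX[of X] by simp
  show "U \<bullet> S = - (\<xi> * l1_norm S)"
    using le[of 0 Z] le[of "2 *\<^sub>R S" Z] by (simp add: inner_simps distrib_left UX UX2 l1_norm_scaleR)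
qed


section \<open>The ADMIP iteration\<close>

locale admip_run =
  fixes D :: "real ^ 'n::finite ^ 'm::finite"
    and \<Omega> :: "('m \<times> 'n) set"
    and \<delta> \<xi> :: real
    and \<rho> \<theta> :: "nat \<Rightarrow> real"
    and L Z S Y :: "nat \<Rightarrow> real ^ 'n ^ 'm"
  assumes delta: "0 < \<delta>" and xi: "0 < \<xi>"
    and rho_pos: "0 < \<rho> k"
    and rho_mono: "\<rho> k \<le> \<rho> (Suc k)"
    and rho_lim: "filterlim \<rho> at_top sequentially"
    and iterates: "admip \<xi> \<Omega> D \<delta> \<rho> L Z S Y"
    and multipliers: "optimal_multiplier \<xi> \<Omega> D \<delta> (\<rho> k) (Y k) (L (Suc k)) (\<theta> k)"
begin

abbreviation h where "h \<equiv> sparse_cost \<xi> \<Omega> D \<delta>"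

definition residual where "residual k = proj_on \<Omega> (Z k + S k - D)"

lemma L_argmin: "is_arg_min (L_objective (\<rho> k) (Y k) (Z k)) (\<lambda>_. True) (L (Suc k))"
  and ZS_argmin: "is_arg_min (ZS_objective \<xi> (\<rho> k) (Y k) (L (Suc k))) (spcp_feasible \<Omega> D \<delta>) (Z (Suc k), S (Suc k))"
  and Y_update: "Y (Suc k) = Y k + \<rho> k *\<^sub>R (L (Suc k) - Z (Suc k))"
  using iterates by (simp_all add: admip_def)

lemma delta_nonneg: "0 \<le> \<delta>" and xi_nonneg: "0 \<le> \<xi>" and rho_nonneg: "0 \<le> \<rho> k"
  using delta xi rho_pos[of k] by simp_all

lemma feasible_iterate: "spcp_feasible \<Omega> D \<delta> (Z (Suc k), S (Suc k))"
  using ZS_argmin[of k] by (simp add: is_arg_min_linorder)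

lemma sparse_step:
  assumes "spcp_feasible \<Omega> D \<delta> (Z', S')"
  shows "\<xi> * l1_norm (S (Suc k)) + Y (Suc k) \<bullet> (Z' - Z (Suc k)) \<le> \<xi> * l1_norm S'"
  using ZS_step_subgradient[OF xi_nonneg ZS_argmin[of k] assms] by (simp add: Y_update)

lemma sparse_cost_iterate: "\<xi> * l1_norm (S (Suc k)) = h (Z (Suc k))"
proof (rule antisym)
  show "\<xi> * l1_norm (S (Suc k)) \<le> h (Z (Suc k))"
    using sparse_step[where k = k and Z' = "Z (Suc k)"] by (intro sparse_cost_greatest xi delta_nonneg) simp
qed (intro sparse_cost_le xi delta_nonneg feasible_iterate)

lemma sparse_cost_subgradient: "subgradient h (Z (Suc k)) (Y (Suc k))"
  unfolding subgradient_def using sparse_step[where k = k]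
  by (intro allI sparse_cost_greatest xi delta_nonneg) (simp add: sparse_cost_iterate)

sublocale splitting: increasing_penalty_splitting nuclear_norm h \<rho> L Z Y
  "max (real CARD('n)) (\<xi> * (CARD('m) * CARD('n)))"
proof
  let ?K = "max (real CARD('n)) (\<xi> * (CARD('m) * CARD('n)))"
  have K: "CARD('n) * norm A \<le> ?K * norm A" "\<xi> * (CARD('m) * CARD('n)) * norm A \<le> ?K * norm A" for A :: "real ^ 'n ^ 'm"
    by (intro mult_right_mono; simp)+
  show "?K-lipschitz_on UNIV (nuclear_norm :: real ^ 'n ^ 'm \<Rightarrow> real)"
  proof (rule lipschitz_onI)
    fix A B :: "real ^ 'n ^ 'm"
    show "dist (nuclear_norm A) (nuclear_norm B) \<le> ?K * dist A B"
      using nuclear_norm_diff_le[of A B] nuclear_norm_diff_le[of B A] K(1)[of "A - B"]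
      by (simp add: dist_norm norm_minus_commute abs_le_iff)
  qed simp
  show "?K-lipschitz_on UNIV h"
  proof (rule lipschitz_onI)
    fix A B :: "real ^ 'n ^ 'm"
    show "dist (h A) (h B) \<le> ?K * dist A B"
      using sparse_cost_diff_le[OF xi delta_nonneg, of \<Omega> D A B]
        sparse_cost_diff_le[OF xi delta_nonneg, of \<Omega> D B A] K(2)[of "A - B"]
      by (simp add: dist_norm norm_minus_commute abs_le_iff)
  qed simp
qed (use nuclear_sparse_saddle_exists[OF xi delta_nonneg] rho_pos rho_mono rho_lim
    L_step_subgradient[OF L_argmin] sparse_cost_subgradient Y_update in auto)

lemma primal_convergence:
  assumes "\<not> summable (\<lambda>k. 1 / \<rho> k)"
  obtains Ls Ss where "Z \<longlonglongrightarrow> Ls" "L \<longlonglongrightarrow> Ls" "S \<longlonglongrightarrow> Ss" "spcp_feasible \<Omega> D \<delta> (Ls, Ss)"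
    "\<xi> * l1_norm Ss = h Ls" "spcp_solution \<xi> \<Omega> D \<delta> Ls Ss"
proof -
  obtain Ls where Ls: "Z \<longlonglongrightarrow> Ls" "L \<longlonglongrightarrow> Ls" "\<And>X. nuclear_norm Ls + h Ls \<le> nuclear_norm X + h X"
    using splitting.converges_to_minimizer[OF assms] by blast
  obtain Ss where Ss: "(\<lambda>k. S (Suc k)) \<longlonglongrightarrow> Ss" "spcp_feasible \<Omega> D \<delta> (Ls, Ss)" "\<xi> * l1_norm Ss = h Ls"
    using sparse_minimizers_converge[OF xi delta_nonneg LIMSEQ_Suc[OF Ls(1)] feasible_iterate sparse_cost_iterate]
    by blast
  have "nuclear_norm Ls + \<xi> * l1_norm Ss \<le> nuclear_norm X + \<xi> * l1_norm T"
    if "spcp_feasible \<Omega> D \<delta> (X, T)" for X T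
    using Ls(3)[of X] sparse_cost_le[OF xi delta_nonneg that] Ss(3) by simp
  then have "spcp_solution \<xi> \<Omega> D \<delta> Ls Ss"
    using Ss(2) by (auto simp: spcp_solution_def is_arg_min_linorder)
  with Ls(1,2) Ss LIMSEQ_imp_Suc[OF Ss(1)] that show thesis by blast
qed

lemma multiplier_nonneg: "0 \<le> \<theta> k"
  and complementary_slackness: "\<theta> k * ((norm (residual (Suc k)))\<^sup>2 - \<delta>\<^sup>2) = 0"
  using optimal_multiplier_saddle(1,2)[OF xi_nonneg delta rho_nonneg ZS_argmin multipliers, of k]
  by (simp_all add: residual_def)

lemma multiplier_lagrangian:
  "\<xi> * l1_norm (S (Suc k)) + \<theta> k / 2 * (norm (residual (Suc k)))\<^sup>2 - Y (Suc k) \<bullet> Z (Suc k)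
    \<le> \<xi> * l1_norm S' + \<theta> k / 2 * (norm (proj_on \<Omega> (Z' + S' - D)))\<^sup>2 - Y (Suc k) \<bullet> Z'"
  unfolding residual_def
  by (rule ZS_step_lagrangian[OF xi_nonneg delta rho_nonneg ZS_argmin multipliers Y_update])

lemma dual_eq: "Y (Suc k) = \<theta> k *\<^sub>R residual (Suc k)"
  and dual_inner_sparse: "Y (Suc k) \<bullet> S (Suc k) = - (\<xi> * l1_norm (S (Suc k)))"
  using ZS_step_stationarity[OF xi_nonneg multiplier_lagrangian[of k, unfolded residual_def]]
  by (auto simp: residual_def)

text \<open>
  Where \<open>\<theta> k \<noteq> 0\<close> the constraint is active, so \<open>\<theta> k * \<delta> = norm (Y (Suc k))\<close>.
\<close>

lemma multiplier_bounded: "bounded (range \<theta>)"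
proof -
  let ?K = "max (real CARD('n)) (\<xi> * (CARD('m) * CARD('n)))"
  have "norm (\<theta> k) \<le> ?K / \<delta>" for k
  proof (cases "\<theta> k = 0")
    case False
    then have "norm (residual (Suc k)) = \<delta>"
      using complementary_slackness[of k] delta by (simp add: power2_eq_iff_nonneg)
    then have "\<theta> k * \<delta> \<le> ?K"
      using splitting.dual_bounded[of k] multiplier_nonneg[of k] by (simp add: dual_eq)
    then show ?thesis using delta multiplier_nonneg[of k] by (simp add: field_simps)
  qed (use delta xi in \<open>simp add: max_def\<close>)
  then show ?thesis unfolding bounded_iff by blast
qed

lemma dual_sequence_bounded: "bounded (range Y)"
proof -
  have "range Y \<subseteq> insert (Y 0) (range (\<lambda>k. Y (Suc k)))"
    by (auto simp: image_iff) (metis not0_implies_Suc)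
  moreover have "bounded (range (\<lambda>k. Y (Suc k)))"
    unfolding bounded_iff using splitting.dual_bounded by blast
  ultimately show ?thesis by (metis bounded_insert bounded_subset)
qed

lemma sparse_limit_zero:
  assumes "\<xi> * l1_norm Ss = h Ls" "norm (proj_on \<Omega> (D - Ls)) \<le> \<delta>"
  shows "Ss = 0"
proof -
  have "spcp_feasible \<Omega> D \<delta> (Ls, 0)"
    using assms(2) by (simp add: spcp_feasible_iff proj_on_diff norm_minus_commute)
  from sparse_cost_le[OF xi delta_nonneg this] have "\<xi> * l1_norm Ss \<le> 0" by (simp add: assms(1))
  then have "l1_norm Ss \<le> 0" using xi by (simp add: mult_le_0_iff)
  then have "norm Ss \<le> 0" using norm_le_l1_norm[of Ss] by linarith
  then show ?thesis by simp
qed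

text \<open>
  If \<open>S = 0\<close> is strictly feasible for \<open>Ls\<close>, the constraint is eventually inactive. Otherwise \<open>Ss \<noteq> 0\<close>,
  and the stationarity conditions combine to \<open>\<theta> k * (residual (Suc k) \<bullet> S (Suc k)) = - (\<xi> * l1_norm (S (Suc k)))\<close>,
  whose right hand side has a nonzero limit. As \<open>\<theta>\<close> is bounded, the factor of \<open>\<theta> k\<close> cannot tend to
  \<open>0\<close>, and one can divide by it.
\<close>

lemma multiplier_converges:
  assumes Z: "Z \<longlonglongrightarrow> Ls" and S: "S \<longlonglongrightarrow> Ss"
    and opt: "spcp_feasible \<Omega> D \<delta> (Ls, Ss)" "\<xi> * l1_norm Ss = h Ls"
    and ne: "norm (proj_on \<Omega> (D - Ls)) \<noteq> \<delta>"
  obtains \<theta>s where "\<theta> \<longlonglongrightarrow> \<theta>s"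
proof -
  define Rs where "Rs = proj_on \<Omega> (Ls + Ss - D)"
  have Rlim: "(\<lambda>k. residual (Suc k)) \<longlonglongrightarrow> Rs"
    unfolding residual_def Rs_def by (intro tendsto_intros tendsto_proj_on LIMSEQ_Suc Z S)
  have R0: "norm (proj_on \<Omega> (D - Ls)) = norm (proj_on \<Omega> (Ls + 0 - D))"
    by (simp add: proj_on_diff norm_minus_commute)
  show thesis
  proof (cases "norm (proj_on \<Omega> (D - Ls)) < \<delta>")
    case True
    then have "Ss = 0" by (intro sparse_limit_zero[OF opt(2)]) simp
    then have "norm Rs < \<delta>" using True R0 by (simp add: Rs_def)
    then have "\<forall>\<^sub>F k in sequentially. norm (residual (Suc k)) < \<delta>"
      by (intro order_tendstoD(2)[OF tendsto_norm[OF Rlim]])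
    then have "\<forall>\<^sub>F k in sequentially. \<theta> k = 0"
    proof eventually_elim
      case (elim k)
      then have "(norm (residual (Suc k)))\<^sup>2 < \<delta>\<^sup>2" using delta by (intro power_strict_mono) auto
      then show ?case using complementary_slackness[of k] by simp
    qed
    then have "\<theta> \<longlonglongrightarrow> 0" by (simp add: tendsto_eventually)
    then show thesis by (rule that)
  next
    case False
    have "Ss \<noteq> 0"
      using opt(1) False ne R0 by (auto simp: spcp_feasible_iff)
    define a where "a k = residual (Suc k) \<bullet> S (Suc k)" for k
    define b where "b k = - (\<xi> * l1_norm (S (Suc k)))" for k
    have ab: "\<theta> k * a k = b k" for k
      using dual_inner_sparse[of k] by (simp add: a_def b_def dual_eq)
    have a: "a \<longlonglongrightarrow> Rs \<bullet> Ss"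
      unfolding a_def by (intro tendsto_intros Rlim LIMSEQ_Suc S)
    have b: "b \<longlonglongrightarrow> - (\<xi> * l1_norm Ss)"
      unfolding b_def by (intro tendsto_intros tendsto_l1_norm LIMSEQ_Suc S)
    have b0: "- (\<xi> * l1_norm Ss) \<noteq> 0"
      using \<open>Ss \<noteq> 0\<close> xi by (simp add: l1_norm_eq_zero_iff)
    have a0: "Rs \<bullet> Ss \<noteq> 0"
    proof
      assume 0: "Rs \<bullet> Ss = 0"
      obtain M where M: "\<And>k. norm (\<theta> k) \<le> M" using multiplier_bounded unfolding bounded_iff by auto
      have "b \<longlonglongrightarrow> 0"
      proof (rule Lim_null_comparison)
        show "\<forall>\<^sub>F k in sequentially. norm (b k) \<le> M * norm (a k)"
          using M by (intro always_eventually allI) (simp add: ab[symmetric] abs_mult mult_right_mono)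
        show "(\<lambda>k. M * norm (a k)) \<longlonglongrightarrow> 0"
          using tendsto_mult[OF tendsto_const tendsto_norm[OF a], of M] 0 by simp
      qed
      then show False using LIMSEQ_unique[OF b] b0 by blast
    qed
    have "(\<lambda>k. b k / a k) \<longlonglongrightarrow> - (\<xi> * l1_norm Ss) / (Rs \<bullet> Ss)"
      by (intro tendsto_divide a b a0)
    moreover have "\<forall>\<^sub>F k in sequentially. b k / a k = \<theta> k"
      using tendsto_imp_eventually_ne[OF a a0] by eventually_elim (simp add: ab[symmetric])
    ultimately have "\<theta> \<longlonglongrightarrow> - (\<xi> * l1_norm Ss) / (Rs \<bullet> Ss)"
      by (rule Lim_transform_eventually)
    then show thesis by (rule that)
  qed
qed

lemma dual_convergence:
  assumes div: "\<not> summable (\<lambda>k. 1 / (\<rho> k)\<^sup>2)"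
    and Z: "Z \<longlonglongrightarrow> Ls" and L: "L \<longlonglongrightarrow> Ls" and S: "S \<longlonglongrightarrow> Ss" and \<theta>: "\<theta> \<longlonglongrightarrow> \<theta>s"
    and feas: "spcp_feasible \<Omega> D \<delta> (Ls, Ss)"
  obtains Ys where "Y \<longlonglongrightarrow> Ys" "lagrangian_saddle_point \<xi> \<Omega> D \<delta> Ls Ls Ss Ys \<theta>s"
proof -
  define Rs where "Rs = proj_on \<Omega> (Ls + Ss - D)"
  define Ys where "Ys = \<theta>s *\<^sub>R Rs"
  have Rlim: "(\<lambda>k. residual (Suc k)) \<longlonglongrightarrow> Rs"
    unfolding residual_def Rs_def by (intro tendsto_intros tendsto_proj_on LIMSEQ_Suc Z S)
  have Y': "(\<lambda>k. Y (Suc k)) \<longlonglongrightarrow> Ys" unfolding dual_eq Ys_def by (intro tendsto_intros \<theta> Rlim)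
  then have Y: "Y \<longlonglongrightarrow> Ys" by (rule LIMSEQ_imp_Suc)
  have f: "subgradient nuclear_norm Ls (- Ys)"
    by (rule splitting.dual_limit_is_subgradient[OF div L Y])
  have \<theta>0: "0 \<le> \<theta>s" using multiplier_nonneg by (intro LIMSEQ_le_const[OF \<theta>]) auto
  have "(\<lambda>k. \<theta> k * ((norm (residual (Suc k)))\<^sup>2 - \<delta>\<^sup>2)) \<longlonglongrightarrow> \<theta>s * ((norm Rs)\<^sup>2 - \<delta>\<^sup>2)"
    by (intro tendsto_intros \<theta> Rlim)
  then have slack: "\<theta>s * ((norm Rs)\<^sup>2 - \<delta>\<^sup>2) = 0"
    unfolding complementary_slackness by (simp add: LIMSEQ_const_iff)
  have feas': "(norm Rs)\<^sup>2 - \<delta>\<^sup>2 \<le> 0"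
    using feas by (simp add: spcp_feasible_iff Rs_def power_mono)
  have zs: "\<xi> * l1_norm Ss + \<theta>s / 2 * (norm Rs)\<^sup>2 - Ys \<bullet> Ls
      \<le> \<xi> * l1_norm S' + \<theta>s / 2 * (norm (proj_on \<Omega> (Z' + S' - D)))\<^sup>2 - Ys \<bullet> Z'" for Z' S'
  proof (rule LIMSEQ_le)
    show "(\<lambda>k. \<xi> * l1_norm (S (Suc k)) + \<theta> k / 2 * (norm (residual (Suc k)))\<^sup>2 - Y (Suc k) \<bullet> Z (Suc k))
        \<longlonglongrightarrow> \<xi> * l1_norm Ss + \<theta>s / 2 * (norm Rs)\<^sup>2 - Ys \<bullet> Ls"
      by (intro tendsto_intros tendsto_l1_norm \<theta> Rlim Y' LIMSEQ_Suc Z S) simp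
    show "(\<lambda>k. \<xi> * l1_norm S' + \<theta> k / 2 * (norm (proj_on \<Omega> (Z' + S' - D)))\<^sup>2 - Y (Suc k) \<bullet> Z')
        \<longlonglongrightarrow> \<xi> * l1_norm S' + \<theta>s / 2 * (norm (proj_on \<Omega> (Z' + S' - D)))\<^sup>2 - Ys \<bullet> Z'"
      by (intro tendsto_intros \<theta> Y') simp
  qed (use multiplier_lagrangian in blast)
  have "lagrangian_saddle_point \<xi> \<Omega> D \<delta> Ls Ls Ss Ys \<theta>s"
    unfolding lagrangian_saddle_point_def
  proof (intro conjI allI impI \<theta>0)
    fix Y' \<theta>' assume "0 \<le> (\<theta>' :: real)"
    then have "\<theta>' * ((norm Rs)\<^sup>2 - \<delta>\<^sup>2) \<le> 0" using feas' by (simp add: mult_nonneg_nonpos)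
    then have "\<theta>' * ((norm Rs)\<^sup>2 - \<delta>\<^sup>2) \<le> \<theta>s * ((norm Rs)\<^sup>2 - \<delta>\<^sup>2)" unfolding slack .
    then show "lagrangian \<xi> \<Omega> D \<delta> Ls Ls Ss Y' \<theta>' \<le> lagrangian \<xi> \<Omega> D \<delta> Ls Ls Ss Ys \<theta>s"
      by (simp add: lagrangian_def flip: Rs_def)
  next
    fix L' Z' S'
    have split: "lagrangian \<xi> \<Omega> D \<delta> A B C Ys \<theta>s = nuclear_norm A + \<xi> * l1_norm C + (Ys \<bullet> A - Ys \<bullet> B)
        + (\<theta>s / 2 * (norm (proj_on \<Omega> (B + C - D)))\<^sup>2 - \<theta>s / 2 * \<delta>\<^sup>2)" for A B C
      unfolding lagrangian_def inner_diff_right right_diff_distrib by simp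
    have "nuclear_norm Ls + Ys \<bullet> Ls \<le> nuclear_norm L' + Ys \<bullet> L'"
      using subgradientD[OF f, of L'] by (simp add: inner_diff_right)
    then show "lagrangian \<xi> \<Omega> D \<delta> Ls Ls Ss Ys \<theta>s \<le> lagrangian \<xi> \<Omega> D \<delta> L' Z' S' Ys \<theta>s"
      using zs[of S' Z'] unfolding split Rs_def by linarith
  qed
  with Y that show thesis by blast
qed

text \<open>
  Here \<open>S = 0\<close> is feasible for \<open>Ls\<close>, so \<open>Ss = 0\<close> and the constraint is active at \<open>(Ls, Ss)\<close>: all dual
  variables give the same value of the Lagrangian.
\<close>

lemma dual_limit_point:
  assumes opt: "spcp_feasible \<Omega> D \<delta> (Ls, Ss)" "\<xi> * l1_norm Ss = h Ls"
    and eq: "norm (proj_on \<Omega> (D - Ls)) = \<delta>"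
  obtains Ys \<theta>s r where "strict_mono (r :: nat \<Rightarrow> nat)" "(\<lambda>k. (Y (r k), \<theta> (r k))) \<longlonglongrightarrow> (Ys, \<theta>s)"
    "is_arg_max (\<lambda>(Y, \<theta>). lagrangian \<xi> \<Omega> D \<delta> Ls Ls Ss Y \<theta>) (\<lambda>(Y, \<theta>). 0 \<le> \<theta>) (Ys, \<theta>s)"
proof -
  have eq': "norm (proj_on \<Omega> (Ls - D)) = \<delta>" using eq by (simp add: proj_on_diff norm_minus_commute)
  have "Ss = 0" by (rule sparse_limit_zero[OF opt(2)]) (simp add: eq)
  then have const: "lagrangian \<xi> \<Omega> D \<delta> Ls Ls Ss Y' \<theta>' = nuclear_norm Ls" for Y' \<theta>'
    by (simp add: lagrangian_def eq')
  have "bounded (range (\<lambda>k. (Y k, \<theta> k)))"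
    by (rule bounded_subset[OF bounded_Times[OF dual_sequence_bounded multiplier_bounded]]) auto
  then obtain l r where r: "strict_mono (r :: nat \<Rightarrow> nat)" "((\<lambda>k. (Y k, \<theta> k)) \<circ> r) \<longlonglongrightarrow> l"
    using bounded_imp_convergent_subsequence by blast
  obtain Ys \<theta>s where l: "l = (Ys, \<theta>s)" by (cases l)
  have "(\<lambda>k. \<theta> (r k)) \<longlonglongrightarrow> \<theta>s" using tendsto_snd[OF r(2)] by (simp add: l o_def)
  then have "0 \<le> \<theta>s" using multiplier_nonneg by (intro LIMSEQ_le_const) auto
  then have "is_arg_max (\<lambda>(Y, \<theta>). lagrangian \<xi> \<Omega> D \<delta> Ls Ls Ss Y \<theta>) (\<lambda>(Y, \<theta>). 0 \<le> \<theta>) (Ys, \<theta>s)"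
    by (auto simp: is_arg_max_linorder const)
  with r l that show thesis by (simp add: o_def)
qed

end

lemma not_summable_inverse_of_inverse_square:
  fixes \<rho> :: "nat \<Rightarrow> real"
  assumes "\<not> summable (\<lambda>k. 1 / (\<rho> k)\<^sup>2)" "filterlim \<rho> at_top sequentially"
  shows "\<not> summable (\<lambda>k. 1 / \<rho> k)"
proof
  assume "summable (\<lambda>k. 1 / \<rho> k)"
  moreover have "\<forall>\<^sub>F k in sequentially. norm (1 / (\<rho> k)\<^sup>2) \<le> 1 / \<rho> k"
    using filterlim_at_top_dense[THEN iffD1, OF assms(2), rule_format, of 1]
    by eventually_elim (simp add: field_simps power2_eq_square)
  ultimately have "summable (\<lambda>k. 1 / (\<rho> k)\<^sup>2)" by (rule summable_comparison_test_ev[rotated])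
  with assms(1) show False ..
qed

lemma not_summable_of_suminf_ennreal:
  assumes "(\<Sum>k. ennreal (w k)) = \<infinity>" "\<And>k. 0 \<le> w k"
  shows "\<not> summable w"
  using ennreal_suminf_neq_top[of w] assms by auto

theorem theorem3p3:
  fixes D :: "real ^ 'n ^ 'm"
    and \<Omega> :: "('m \<times> 'n) set"
    and \<delta> \<xi> :: real
    and \<rho> \<theta> :: "nat \<Rightarrow> real"
    and L Z S Y :: "nat \<Rightarrow> real ^ 'n ^ 'm"
  assumes delta: "\<delta> > 0"
    and xi: "\<xi> = 1 / sqrt (real (max CARD('m) CARD('n)))"
    and rho_pos: "\<And>k. \<rho> k > 0"
    and rho_mono: "\<And>k. \<rho> k \<le> \<rho> (Suc k)"
    and rho_lim: "filterlim \<rho> at_top sequentially"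
    and iterates: "admip \<xi> \<Omega> D \<delta> \<rho> L Z S Y"
    and multipliers: "\<And>k. optimal_multiplier \<xi> \<Omega> D \<delta> (\<rho> k) (Y k) (L (Suc k)) (\<theta> k)"
  shows
    "((\<Sum>k. ennreal (1 / \<rho> k)) = \<infinity> \<longrightarrow>
       (\<exists>Ls Ss. Z \<longlonglongrightarrow> Ls \<and> L \<longlonglongrightarrow> Ls \<and> S \<longlonglongrightarrow> Ss \<and> spcp_solution \<xi> \<Omega> D \<delta> Ls Ss)) \<and>
     ((\<Sum>k. ennreal (1 / (\<rho> k)\<^sup>2)) = \<infinity> \<longrightarrow>
       (\<exists>Ls Ss. Z \<longlonglongrightarrow> Ls \<and> L \<longlonglongrightarrow> Ls \<and> S \<longlonglongrightarrow> Ss \<and>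
          (norm (proj_on \<Omega> (D - Ls)) \<noteq> \<delta> \<longrightarrow>
             (\<exists>Ys \<theta>s. (\<lambda>k. (Y k, \<theta> k)) \<longlonglongrightarrow> (Ys, \<theta>s) \<and>
                lagrangian_saddle_point \<xi> \<Omega> D \<delta> Ls Ls Ss Ys \<theta>s)) \<and>
          (norm (proj_on \<Omega> (D - Ls)) = \<delta> \<longrightarrow>
             (\<exists>Ys \<theta>s r. strict_mono (r :: nat \<Rightarrow> nat) \<and>
                (\<lambda>k. (Y (r k), \<theta> (r k))) \<longlonglongrightarrow> (Ys, \<theta>s) \<and>
                is_arg_max (\<lambda>(Y, \<theta>). lagrangian \<xi> \<Omega> D \<delta> Ls Ls Ss Y \<theta>) (\<lambda>(Y, \<theta>). 0 \<le> \<theta>) (Ys, \<theta>s)))))"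
proof -
  have "0 < \<xi>" unfolding xi by (simp add: max_def)
  then interpret admip_run D \<Omega> \<delta> \<xi> \<rho> \<theta> L Z S Y
    by unfold_locales (use delta rho_pos rho_mono rho_lim iterates multipliers in auto)
  show ?thesis
  proof (intro conjI impI)
    assume "(\<Sum>k. ennreal (1 / \<rho> k)) = \<infinity>"
    then have "\<not> summable (\<lambda>k. 1 / \<rho> k)"
      using rho_nonneg by (intro not_summable_of_suminf_ennreal) auto
    then show "\<exists>Ls Ss. Z \<longlonglongrightarrow> Ls \<and> L \<longlonglongrightarrow> Ls \<and> S \<longlonglongrightarrow> Ss \<and> spcp_solution \<xi> \<Omega> D \<delta> Ls Ss"
      by (rule primal_convergence) blast
  next
    assume "(\<Sum>k. ennreal (1 / (\<rho> k)\<^sup>2)) = \<infinity>"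
    then have div: "\<not> summable (\<lambda>k. 1 / (\<rho> k)\<^sup>2)"
      by (intro not_summable_of_suminf_ennreal) auto
    obtain Ls Ss where lim: "Z \<longlonglongrightarrow> Ls" "L \<longlonglongrightarrow> Ls" "S \<longlonglongrightarrow> Ss"
      and opt: "spcp_feasible \<Omega> D \<delta> (Ls, Ss)" "\<xi> * l1_norm Ss = h Ls"
      using primal_convergence[OF not_summable_inverse_of_inverse_square[OF div rho_lim]] by metis
    have "\<exists>Ys \<theta>s. (\<lambda>k. (Y k, \<theta> k)) \<longlonglongrightarrow> (Ys, \<theta>s) \<and> lagrangian_saddle_point \<xi> \<Omega> D \<delta> Ls Ls Ss Ys \<theta>s"
      if ne: "norm (proj_on \<Omega> (D - Ls)) \<noteq> \<delta>"
    proof -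
      obtain \<theta>s where \<theta>s: "\<theta> \<longlonglongrightarrow> \<theta>s" by (rule multiplier_converges[OF lim(1,3) opt ne])
      obtain Ys where "Y \<longlonglongrightarrow> Ys" "lagrangian_saddle_point \<xi> \<Omega> D \<delta> Ls Ls Ss Ys \<theta>s"
        by (rule dual_convergence[OF div lim \<theta>s opt(1)])
      then show ?thesis using tendsto_Pair[OF _ \<theta>s] by blast
    qed
    moreover have "\<exists>Ys \<theta>s r. strict_mono (r :: nat \<Rightarrow> nat) \<and> (\<lambda>k. (Y (r k), \<theta> (r k))) \<longlonglongrightarrow> (Ys, \<theta>s) \<and>
        is_arg_max (\<lambda>(Y, \<theta>). lagrangian \<xi> \<Omega> D \<delta> Ls Ls Ss Y \<theta>) (\<lambda>(Y, \<theta>). 0 \<le> \<theta>) (Ys, \<theta>s)"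
      if "norm (proj_on \<Omega> (D - Ls)) = \<delta>"
      by (rule dual_limit_point[OF opt that]) blast
    ultimately show "\<exists>Ls Ss. Z \<longlonglongrightarrow> Ls \<and> L \<longlonglongrightarrow> Ls \<and> S \<longlonglongrightarrow> Ss \<and>
          (norm (proj_on \<Omega> (D - Ls)) \<noteq> \<delta> \<longrightarrow>
             (\<exists>Ys \<theta>s. (\<lambda>k. (Y k, \<theta> k)) \<longlonglongrightarrow> (Ys, \<theta>s) \<and>
                lagrangian_saddle_point \<xi> \<Omega> D \<delta> Ls Ls Ss Ys \<theta>s)) \<and>
          (norm (proj_on \<Omega> (D - Ls)) = \<delta> \<longrightarrow>
             (\<exists>Ys \<theta>s r. strict_mono (r :: nat \<Rightarrow> nat) \<and>
                (\<lambda>k. (Y (r k), \<theta> (r k))) \<longlonglongrightarrow> (Ys, \<theta>s) \<and>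
                is_arg_max (\<lambda>(Y, \<theta>). lagrangian \<xi> \<Omega> D \<delta> Ls Ls Ss Y \<theta>) (\<lambda>(Y, \<theta>). 0 \<le> \<theta>) (Ys, \<theta>s)))"
      using lim by blast
  qed
qed

end
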